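(* Let $f:\mathbb R^d\to\mathbb R$ be $L_{\mathbf S}$-self-concordant in the range of $\mathbf S$ for sketches $\mathbf S\sim\mathcal D$, and $L_{\text{semi}}$-semi-strongly self-concordant. Suppose that for some $\tau>0$, $\mathbb E_{\mathbf S\sim\mathcal D}[\mathbf P_x]=\frac\tau d\mathbf I$ for all $x\in\mathbb R^d$. Let $x^0,\dots,x^k$ be iterates of SGN with parameter $L_{\text{alg}}\ge L_{\text{semi}}$ such that, for all $t=0,\dots,k$, $\|\nabla_{\mathbf S_t}f(x^t)\|^*_{x^t,\mathbf S_t}\le\frac1{L_{\text{semi}}}$ and $\nabla f(x^t)\in\mathrm{Range}(\nabla^2 f(x^t))$. Then $$\mathbb E\left[f(x^k)-f^*\right]\le\left(1-\frac{\tau}{bd}\right)^k(f(x^0)-f^* ),\qquad b=\max\left\{\sqrt{\frac{L_{\text{alg}}}{L_{\text{semi}}}},\,2\right\}.$$ Consequently the local iteration complexity of SGN (number of iterations $k$, when $\|\nabla_{\mathbf S_t}f(x^t)\|^*_{x^t,\mathbf S_t}\le\frac1{L_{\text{semi}}}$ and $\nabla f(x^t)\in\mathrm{Range}(\nabla^2 f(x^t))$ for all $t=0,\dots,k$, sufficient for $\mathbb E[f(x^k)-f^*]\le\varepsilon(f(x^0)-f^* )$, $0<\varepsilon<1$) is independent of the problem conditioning: it is $\mathcal O\left(\sqrt{\frac{L_{\text{alg}}}{L_{\text{semi}}}}\frac d\tau\log\frac1\varepsilon\right)$, and $\mathcal O\left(\frac d\tau\log\frac1\varepsilon\right)$ when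 $L_{\text{alg}}=L_{\text{semi}}$, with absolute constants in $\mathcal O$.
   Context: Throughout, $f:\mathbb R^d\to\mathbb R$ is convex with positive definite Hessian (three times differentiable where third derivatives are used), bounded from below, with minimizer $x^*$ and $f^*=f(x^* )$. Local norms: $\|h\|_x=\langle\nabla^2 f(x)h,h\rangle^{1/2}$ and $\|g\|_x^*=\langle g,\nabla^2 f(x)^{-1}g\rangle^{1/2}$. $f$ is $L_{\text{semi}}$-semi-strongly self-concordant if for all $x,y\in\mathbb R^d$, $\sup_{v\ne0}\frac{\|(\nabla^2 f(y)-\nabla^2 f(x))v\|_x^*}{\|v\|_x}\le L_{\text{semi}}\|y-x\|_x$. $f$ is $L_{\mathbf S}$-self-concordant in the range of $\mathbf S\in\mathbb R^{d\times\tau(\mathbf S)}$ if $|\nabla^3f(x)[\mathbf Sh,\mathbf Sh,\mathbf Sh]|\le L_{\mathbf S}\|\mathbf Sh\|_x^3$ for all $x\in\mathbb R^d$ and $h\in\mathbb R^{\tau(\mathbf S)}\setminus\{0\}$, with $L_{\mathbf S}<\infty$. For $\mathbf S\in\mathbb R^{d\times\tau(\mathbf S)}$: $\nabla_{\mathbf S}f(x)=\mathbf S^\top\nabla f(x)$, $\nabla^2_{\mathbf S}f(x)=\mathbf S^\top\nabla^2 f(x)\mathbf S$, $\|g\|^*_{x,\mathbf S}=\langle g,[\nabla^2_{\mathbf S}f(x)]^\dagger g\rangle^{1/2}$ ($\dagger$ is the Moore–Penrose pseudoinverse), and $\mathbf P_x=\mathbf S(\mathbf S^\top\nabla^2 f(x)\mathbf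 S)^\dagger\mathbf S^\top\nabla^2 f(x)$. SGN (Sketchy Global Newton): given $x^0\in\mathbb R^d$ and $L_{\text{alg}}\ge L_{\text{semi}}>0$, for $k=0,1,2,\dots$ sample $\mathbf S_k\sim\mathcal D$ (independently of the past) and set $x^{k+1}=x^k-\alpha_k\mathbf S_k[\nabla^2_{\mathbf S_k}f(x^k)]^\dagger\nabla_{\mathbf S_k}f(x^k)$, where $\alpha_k=\frac{-1+\sqrt{1+2G_k}}{G_k}$, $G_k=L_{\text{alg}}\|\nabla_{\mathbf S_k}f(x^k)\|^*_{x^k,\mathbf S_k}$ (with $\alpha_k=1$ if $G_k=0$). Conditions on the iterates are understood to hold almost surely. *)

theory Defs
  imports
    "HOL-Probability.Probability"
    "Jordan_Normal_Form.Matrix"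
begin

(* Two kinds of vectors and matrices occur. The ambient space R^d is real^'d, with the
   operations of HOL-Analysis. The sketch dimension varies from sketch to sketch, so objects
   of that dimension are the dimension-carrying vectors and matrices of
   Jordan_Normal_Form.Matrix, whose operations carry a subscript v. Two infix symbols of the
   latter theory are switched off so that they keep their HOL-Analysis meaning. *)

no_notation vec_index (infixl "$" 100)
no_notation scalar_prod (infix "\<bullet>" 70)


section \<open>Derivatives and local norms\<close>

definition grad :: "(real^'d \<Rightarrow> real) \<Rightarrow> real^'d \<Rightarrow> real^'d" where
  "grad f x = (THE g. GDERIV f x :> g)"

definition hess :: "(real^'d \<Rightarrow> real) \<Rightarrow> real^'d \<Rightarrow> real^'d^'d" where
  "hess f x = jacobian (grad f) (at x)"

definition third_deriv ::
  "(real^'d \<Rightarrow> real) \<Rightarrow> real^'d \<Rightarrow> real^'d \<Rightarrow> real^'d \<Rightarrow> real^'d \<Rightarrow> real" where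
  "third_deriv f x u v w = (frechet_derivative (hess f) (at x) u *v v) \<bullet> w"

definition thrice_differentiable :: "(real^'d \<Rightarrow> real) \<Rightarrow> bool" where
  "thrice_differentiable f \<longleftrightarrow>
     (\<forall>x. f differentiable (at x) \<and> grad f differentiable (at x) \<and> hess f differentiable (at x))"

definition positive_definite :: "real^'d^'d \<Rightarrow> bool" where
  "positive_definite A \<longleftrightarrow>
     Finite_Cartesian_Product.transpose A = A \<and> (\<forall>v. v \<noteq> 0 \<longrightarrow> 0 < (A *v v) \<bullet> v)"

definition local_norm :: "(real^'d \<Rightarrow> real) \<Rightarrow> real^'d \<Rightarrow> real^'d \<Rightarrow> real" where
  "local_norm f x h = sqrt ((hess f x *v h) \<bullet> h)"

definition local_dual_norm :: "(real^'d \<Rightarrow> real) \<Rightarrow> real^'d \<Rightarrow> real^'d \<Rightarrow> real" where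
  "local_dual_norm f x g = sqrt (g \<bullet> (matrix_inv (hess f x) *v g))"

(* The supremum is taken in the extended reals, where it exists unconditionally. *)
definition semi_strongly_self_concordant :: "real \<Rightarrow> (real^'d \<Rightarrow> real) \<Rightarrow> bool" where
  "semi_strongly_self_concordant L f \<longleftrightarrow>
     (\<forall>x y. (SUP v\<in>{v. v \<noteq> 0}.
                ereal (local_dual_norm f x ((hess f y - hess f x) *v v) / local_norm f x v))
             \<le> ereal (L * local_norm f x (y - x)))"


section \<open>Sketches\<close>

(* A sketch matrix S with d rows and any number of columns is the list of its columns. *)
type_synonym 'd sketch = "(real^'d) list"

(* The Borel sigma-algebra on the disjoint union over n of the spaces of d x n matrices. *)
definition sketch_space :: "'d::finite sketch measure" where
  "sketch_space =
     vimage_algebra UNIV (\<lambda>S. (length S, \<lambda>i. if i < length S then S ! i else 0))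
       (count_space UNIV \<Otimes>\<^sub>M (\<Pi>\<^sub>M i\<in>(UNIV :: nat set). borel))"

(* S h *)
definition sketch_apply :: "'d::finite sketch \<Rightarrow> real Matrix.vec \<Rightarrow> real^'d" where
  "sketch_apply S h = (\<Sum>i<length S. vec_index h i *\<^sub>R (S ! i))"

(* The transpose of S applied to v *)
definition sketch_transpose_apply :: "'d::finite sketch \<Rightarrow> real^'d \<Rightarrow> real Matrix.vec" where
  "sketch_transpose_apply S v = Matrix.vec (length S) (\<lambda>i. (S ! i) \<bullet> v)"

definition sketch_grad :: "(real^'d \<Rightarrow> real) \<Rightarrow> 'd sketch \<Rightarrow> real^'d \<Rightarrow> real Matrix.vec" where
  "sketch_grad f S x = sketch_transpose_apply S (grad f x)"

definition sketch_hess :: "(real^'d \<Rightarrow> real) \<Rightarrow> 'd sketch \<Rightarrow> real^'d \<Rightarrow> real Matrix.mat" where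
  "sketch_hess f S x =
     Matrix.mat (length S) (length S) (\<lambda>(i, j). (S ! i) \<bullet> (hess f x *v (S ! j)))"

(* The Moore-Penrose pseudoinverse, by the four Penrose equations. *)
definition pinv :: "real Matrix.mat \<Rightarrow> real Matrix.mat" where
  "pinv A = (THE X. X \<in> carrier_mat (dim_col A) (dim_row A) \<and>
     A * X * A = A \<and> X * A * X = X \<and>
     transpose_mat (A * X) = A * X \<and> transpose_mat (X * A) = X * A)"

definition sketch_dual_norm ::
  "(real^'d \<Rightarrow> real) \<Rightarrow> real^'d \<Rightarrow> 'd sketch \<Rightarrow> real Matrix.vec \<Rightarrow> real" where
  "sketch_dual_norm f x S g = sqrt (scalar_prod g (pinv (sketch_hess f S x) *\<^sub>v g))"

definition sketch_proj :: "(real^'d \<Rightarrow> real) \<Rightarrow> 'd sketch \<Rightarrow> real^'d \<Rightarrow> real^'d^'d" where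
  "sketch_proj f S x =
     matrix (\<lambda>v. sketch_apply S
       (pinv (sketch_hess f S x) *\<^sub>v sketch_transpose_apply S (hess f x *v v)))"

definition self_concordant_in_range :: "real \<Rightarrow> 'd sketch \<Rightarrow> (real^'d \<Rightarrow> real) \<Rightarrow> bool" where
  "self_concordant_in_range L S f \<longleftrightarrow>
     (\<forall>x. \<forall>h \<in> carrier_vec (length S) - {0\<^sub>v (length S)}.
        \<bar>third_deriv f x (sketch_apply S h) (sketch_apply S h) (sketch_apply S h)\<bar>
          \<le> L * local_norm f x (sketch_apply S h) ^ 3)"


section \<open>Sketchy Global Newton\<close>

definition sgn_stepsize :: "real \<Rightarrow> real" where
  "sgn_stepsize G = (if G = 0 then 1 else (- 1 + sqrt (1 + 2 * G)) / G)"

definition sgn_step ::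
  "(real^'d \<Rightarrow> real) \<Rightarrow> real \<Rightarrow> 'd sketch \<Rightarrow> real^'d \<Rightarrow> real^'d" where
  "sgn_step f L_alg S x =
     x - sgn_stepsize (L_alg * sketch_dual_norm f x S (sketch_grad f S x)) *\<^sub>R
           sketch_apply S (pinv (sketch_hess f S x) *\<^sub>v sketch_grad f S x)"

primrec sgn_iterate ::
  "(real^'d \<Rightarrow> real) \<Rightarrow> real \<Rightarrow> real^'d \<Rightarrow> (nat \<Rightarrow> 'd sketch) \<Rightarrow> nat \<Rightarrow> real^'d" where
  "sgn_iterate f L_alg x0 S 0 = x0"
| "sgn_iterate f L_alg x0 S (Suc k) = sgn_step f L_alg (S k) (sgn_iterate f L_alg x0 S k)"

definition sgn_local_regime ::
  "'w measure \<Rightarrow> (real^'d \<Rightarrow> real) \<Rightarrow> real \<Rightarrow> real \<Rightarrow> real^'d \<Rightarrow> (nat \<Rightarrow> 'w \<Rightarrow> 'd sketch) \<Rightarrow> nat \<Rightarrow> bool"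
  where
  "sgn_local_regime M f L_semi L_alg x0 S k \<longleftrightarrow>
     (AE \<omega> in M. \<forall>t\<le>k.
        (let x = sgn_iterate f L_alg x0 (\<lambda>j. S j \<omega>) t in
           sketch_dual_norm f x (S t \<omega>) (sketch_grad f (S t \<omega>) x) \<le> 1 / L_semi \<and>
           grad f x \<in> range (\<lambda>v. hess f x *v v)))"

end

theory Submission
  imports Defs
begin

text \<open>
  Write \<open>H\<^sub>x\<close> for the Hessian at \<open>x\<close>. The sketched projection \<open>P\<^sub>x\<close> is the orthogonal projection onto the
  range \<open>U\<close> of the sketch for the inner product of \<open>H\<^sub>x\<close>, and with the Newton direction \<open>n\<close> (so that
  \<open>H\<^sub>x n = \<nabla>f(x)\<close>) the step moves along \<open>-P\<^sub>x n\<close>, whose local norm is the sketched dual norm \<open>\<gamma>\<close> of the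
  gradient (\<open>sketch_newton_direction\<close>, \<open>sketch_dual_norm_eq\<close>).

  The argument has a one-step part and a probabilistic part. For one step, the cubic upper model shows
  that \<open>f\<close> decreases by at least a definite multiple of \<open>\<gamma>\<^sup>2\<close>. In the other direction the curvature of
  \<open>f\<close> along a line cannot decay quickly, so if \<open>L \<gamma> \<le> 1\<close> then no point of \<open>x + U\<close> improves on
  \<open>f(x)\<close> by more than \<open>17/24 \<gamma>\<^sup>2\<close> (\<open>semi_strong_lower_bound\<close>). The constants fit: one step achieves at
  least the fraction \<open>1/b\<close> of the decrease that is possible within \<open>x + U\<close> (\<open>sgn_step_progress\<close>).

  It remains to see that a random sketch makes the fraction \<open>\<tau>/d\<close> of the gap available on average. The
  local condition bounds the sketched gradient and not the full gradient, so a direct comparison of the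
  gap with the full gradient norm is out of reach. Instead, the assumption that the mean of \<open>P\<^sub>x\<close> is
  the same multiple of the identity at every \<open>x\<close> is rigid: comparing the projections at two points in
  a suitable Hilbert--Schmidt norm, the mean of the squared difference is a linear expression in the two
  means and vanishes (\<open>AE_sketch_proj_eq\<close>). Hence almost surely \<open>P\<^sub>x = P\<close> does not depend on \<open>x\<close>
  (\<open>AE_sketch_proj_constant\<close>), all Hessians split along the range and the kernel of \<open>P\<close>, and \<open>f\<close> is a
  sum of a function of \<open>P x\<close> and a function of \<open>x - P x\<close>. For such \<open>f\<close> the decrease from \<open>x\<close> to
  \<open>x + P (x\<^sup>* - x)\<close> is linear in \<open>P\<close> (\<open>separable_decrease_integral\<close>), so its mean is \<open>\<tau>/d\<close> times
  \<open>f(x) - f(x\<^sup>*)\<close>.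

  Since the current iterate is independent of the next sketch, the two parts combine to a contraction of
  the expected gap by the factor \<open>1 - \<tau>/(b d)\<close> (\<open>sgn_expected_decrease\<close>).
\<close>

section \<open>Projections that are orthogonal for a positive definite matrix\<close>

lemma positive_definite_sym:
  assumes "positive_definite H"
  shows "(H *v u) \<bullet> w = (H *v w) \<bullet> u"
proof -
  have "(H *v u) \<bullet> w = (u v* H) \<bullet> w"
    using assms unfolding positive_definite_def by (metis transpose_matrix_vector)
  also have "\<dots> = u \<bullet> (H *v w)" by (rule dot_lmul_matrix)
  finally show ?thesis by (simp add: inner_commute)
qed

lemma positive_definite_nonneg:
  assumes "positive_definite H"
  shows "0 \<le> (H *v v) \<bullet> v"
  using assms unfolding positive_definite_def by (cases "v = 0") (auto simp: less_imp_le)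

lemma positive_definite_eq_0:
  assumes "positive_definite H" "(H *v v) \<bullet> v = 0"
  shows "v = 0"
  using assms unfolding positive_definite_def by fastforce

lemma linear_frame_sum: "linear (\<lambda>v. \<Sum>r\<leftarrow>rs. (r \<bullet> ((H::real^'d^'d) *v v)) *\<^sub>R r)"
proof (induction rs)
  case Nil
  then show ?case by (simp add: linear_zero)
next
  case (Cons r rs)
  have "linear (\<lambda>v. (r \<bullet> (H *v v)) *\<^sub>R r)"
    by (auto simp: linear_iff matrix_vector_right_distrib matrix_vector_mult_scaleR inner_add_right algebra_simps)
  with Cons show ?case by (simp add: linear_compose_add)
qed

lemma frame_sum_selfadjoint:
  assumes "positive_definite H"
  shows "(H *v (\<Sum>r\<leftarrow>rs. (r \<bullet> (H *v u)) *\<^sub>R r)) \<bullet> w = (H *v u) \<bullet> (\<Sum>r\<leftarrow>rs. (r \<bullet> (H *v w)) *\<^sub>R r)"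
proof (induction rs)
  case Nil
  then show ?case by simp
next
  case (Cons r rs)
  have "(H *v r) \<bullet> w = r \<bullet> (H *v w)" "(H *v u) \<bullet> r = r \<bullet> (H *v u)"
    using positive_definite_sym[OF assms] by (auto simp: inner_commute)
  with Cons show ?case
    by (simp add: matrix_vector_right_distrib matrix_vector_mult_scaleR inner_add_left inner_add_right)
qed

text \<open>
  Orthogonal projection onto the span of a finite list for the inner product of \<open>H\<close>, in the form
  \<open>v \<mapsto> \<Sum>\<^sub>r \<langle>r, H v\<rangle> r\<close> for an \<open>H\<close>-orthonormal family. This form makes linearity
  and self-adjointness evident; together with fixing the listed vectors and having its range in their
  span they characterise the projection.
\<close>
lemma gram_schmidt:
  fixes H :: "real^'d^'d"
  assumes pd: "positive_definite H"
  shows "\<exists>rs. (\<forall>s\<in>set S. (\<Sum>r\<leftarrow>rs. (r \<bullet> (H *v s)) *\<^sub>R r) = s) \<and>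
              (\<forall>v. (\<Sum>r\<leftarrow>rs. (r \<bullet> (H *v v)) *\<^sub>R r) \<in> span (set S))"
proof (induction S)
  case Nil
  have "(\<Sum>r\<leftarrow>([]::(real^'d) list). (r \<bullet> (H *v v)) *\<^sub>R r) \<in> span (set [])" for v
    by (simp add: span_zero)
  then show ?case by (intro exI[of _ "[]"]) auto
next
  case (Cons s S)
  then obtain rs where fix': "\<And>t. t \<in> set S \<Longrightarrow> (\<Sum>r\<leftarrow>rs. (r \<bullet> (H *v t)) *\<^sub>R r) = t"
    and in': "\<And>v. (\<Sum>r\<leftarrow>rs. (r \<bullet> (H *v v)) *\<^sub>R r) \<in> span (set S)" by blast
  define E where "E v = (\<Sum>r\<leftarrow>rs. (r \<bullet> (H *v v)) *\<^sub>R r)" for v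
  have lin: "linear E" unfolding E_def by (rule linear_frame_sum)
  have sa: "(H *v E u) \<bullet> w = (H *v u) \<bullet> E w" for u w
    unfolding E_def by (rule frame_sum_selfadjoint[OF pd])
  have E_fix: "E t = t" if "t \<in> set S" for t using fix' that by (simp add: E_def)
  have E_in: "E v \<in> span (set S)" for v using in' by (simp add: E_def)
  have E_span: "E t = t" if "t \<in> span (set S)" for t
    using linear_eq_on[OF lin linear_ident that] E_fix by auto
  define r where "r = s - E s"
  have orth: "(H *v t) \<bullet> r = 0" if "E t = t" for t
  proof -
    have "(H *v t) \<bullet> E s = (H *v E t) \<bullet> s" using sa by simp
    with that show ?thesis by (simp add: r_def inner_diff_right)
  qed
  have span_le: "span (set S) \<subseteq> span (set (s # S))" by (rule span_mono) auto
  show ?case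
  proof (cases "r = 0")
    case True
    then have "E s = s" by (simp add: r_def)
    then show ?thesis using E_fix E_in span_le by (intro exI[of _ rs]) (auto simp: E_def[symmetric])
  next
    case False
    define q where "q = (H *v r) \<bullet> r"
    have q: "q > 0" using False pd by (simp add: q_def positive_definite_def)
    define r' where "r' = (1 / sqrt q) *\<^sub>R r"
    have upd: "(\<Sum>r\<leftarrow>r' # rs. (r \<bullet> (H *v v)) *\<^sub>R r) = (((H *v v) \<bullet> r) / q) *\<^sub>R r + E v" for v
      using q by (simp add: E_def r'_def inner_commute)
    have "(H *v s) \<bullet> r = q"
    proof -
      have "(H *v E s) \<bullet> r = 0" by (rule orth) (simp add: E_span E_in)
      moreover have "s = r + E s" by (simp add: r_def)
      then have "(H *v s) \<bullet> r = (H *v (r + E s)) \<bullet> r" by simp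
      ultimately show ?thesis
        by (simp add: q_def matrix_vector_right_distrib inner_add_left)
    qed
    then have "(((H *v s) \<bullet> r) / q) *\<^sub>R r + E s = s" using q by (simp add: r_def)
    moreover have "(((H *v t) \<bullet> r) / q) *\<^sub>R r + E t = t" if "t \<in> set S" for t
      using orth[of t] E_fix[OF that] by simp
    moreover have "(((H *v v) \<bullet> r) / q) *\<^sub>R r + E v \<in> span (set (s # S))" for v
    proof -
      have "r \<in> span (set (s # S))" unfolding r_def
        by (rule span_diff) (use span_base[of s "set (s # S)"] E_in span_le in auto)
      then show ?thesis using E_in span_le by (intro span_add span_mul) auto
    qed
    ultimately show ?thesis by (intro exI[of _ "r' # rs"]) (auto simp only: upd set_simps)
  qed
qed

section \<open>The pseudoinverse of a sketched Hessian\<close>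

text \<open>
  In matrix notation \<open>frame_op S\<close> is \<open>S S\<^sup>T\<close> and \<open>compression Z S\<close> is \<open>S\<^sup>T Z S\<close>. The number of columns
  varies with the sketch, and the rule \<open>(S\<^sup>T Z S) (S\<^sup>T Z' S) = S\<^sup>T (Z S S\<^sup>T Z') S\<close> moves every computation
  with matrices of that varying size to linear maps of the fixed ambient space.
\<close>
definition frame_op :: "'d::finite sketch \<Rightarrow> real^'d \<Rightarrow> real^'d" where
  "frame_op S w = (\<Sum>i<length S. (S ! i \<bullet> w) *\<^sub>R (S ! i))"

definition compression :: "(real^'d \<Rightarrow> real^'d) \<Rightarrow> 'd sketch \<Rightarrow> real Matrix.mat" where
  "compression Z S = Matrix.mat (length S) (length S) (\<lambda>(i, j). S ! i \<bullet> Z (S ! j))"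

lemma linear_frame_op: "linear (frame_op S)"
  unfolding frame_op_def
  by (intro linear_compose_sum) (auto simp: linear_iff inner_add_right algebra_simps)

lemma frame_op_in_span: "frame_op S w \<in> span (set S)"
  unfolding frame_op_def by (intro span_sum span_mul span_base) auto

lemma frame_op_sym: "frame_op S u \<bullet> w = u \<bullet> frame_op S w"
  unfolding frame_op_def inner_sum_left inner_sum_right
  by (intro sum.cong) (auto simp: inner_commute)

lemma compression_carrier [simp]: "compression Z S \<in> carrier_mat (length S) (length S)"
  by (simp add: compression_def)

lemma compression_mult:
  assumes "linear Z"
  shows "compression Z S * compression Z' S = compression (\<lambda>v. Z (frame_op S (Z' v))) S"
proof (rule eq_matI)
  fix i j assume "i < dim_row (compression (\<lambda>v. Z (frame_op S (Z' v))) S)"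
    and "j < dim_col (compression (\<lambda>v. Z (frame_op S (Z' v))) S)"
  then have i: "i < length S" and j: "j < length S" by (auto simp: compression_def)
  have "(\<Sum>k<length S. (S ! i \<bullet> Z (S ! k)) * (S ! k \<bullet> Z' (S ! j))) = S ! i \<bullet> Z (frame_op S (Z' (S ! j)))"
    unfolding frame_op_def linear_sum[OF assms] inner_sum_right
    by (intro sum.cong) (auto simp: linear_scale[OF assms])
  then show "(compression Z S * compression Z' S) $$ (i, j) =
      compression (\<lambda>v. Z (frame_op S (Z' v))) S $$ (i, j)"
    using i j by (simp add: compression_def scalar_prod_def lessThan_atLeast0)
qed (auto simp: compression_def)

lemma compression_cong:
  assumes "\<And>s. s \<in> set S \<Longrightarrow> Z s = Z' s"
  shows "compression Z S = compression Z' S"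
  using assms by (intro eq_matI) (auto simp: compression_def)

lemma compression_transpose:
  assumes "\<And>u v. u \<bullet> Z v = v \<bullet> Z u"
  shows "transpose_mat (compression Z S) = compression Z S"
  by (rule eq_matI) (use assms in \<open>auto simp: compression_def\<close>)

text \<open>
  Uniqueness of the Moore--Penrose inverse: two solutions \<open>X\<close>, \<open>Y\<close> of the Penrose equations satisfy
  \<open>A X = A Y\<close> and \<open>X A = Y A\<close>, by transposing \<open>A X = (A Y) (A X)\<close> and its mirror image, whence
  \<open>Y = Y A Y = X A X = X\<close>.
\<close>
lemma pinv_eqI:
  assumes A: "A \<in> carrier_mat m n" and X: "X \<in> carrier_mat n m"
    and 1: "A * X * A = A" and 2: "X * A * X = X"
    and 3: "transpose_mat (A * X) = A * X" and 4: "transpose_mat (X * A) = X * A"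
  shows "pinv A = X"
  unfolding pinv_def
proof (rule the_equality)
  show "X \<in> carrier_mat (dim_col A) (dim_row A) \<and> A * X * A = A \<and> X * A * X = X \<and>
     transpose_mat (A * X) = A * X \<and> transpose_mat (X * A) = X * A"
    using assms by auto
next
  fix Y assume Y: "Y \<in> carrier_mat (dim_col A) (dim_row A) \<and> A * Y * A = A \<and> Y * A * Y = Y \<and>
     transpose_mat (A * Y) = A * Y \<and> transpose_mat (Y * A) = Y * A"
  then have Yc: "Y \<in> carrier_mat n m" using A by auto
  have AX: "A * X \<in> carrier_mat m m" and AY: "A * Y \<in> carrier_mat m m"
    and XA: "X * A \<in> carrier_mat n n" and YA: "Y * A \<in> carrier_mat n n"
    using A X Yc by auto
  have "A * X = (A * Y) * (A * X)"
    using Y assoc_mult_mat[OF AY A X] by simp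
  then have "A * X = transpose_mat ((A * Y) * (A * X))" using 3 by metis
  also have "\<dots> = (A * X) * (A * Y)"
    using transpose_mult[OF AY AX] 3 Y by simp
  also have "\<dots> = A * Y"
    using 1 assoc_mult_mat[OF AX A Yc] by simp
  finally have AXY: "A * X = A * Y" .
  have "X * A = (X * A) * (Y * A)"
    using Y assoc_mult_mat[OF A Yc A] assoc_mult_mat[OF X A YA] by simp
  then have "X * A = transpose_mat ((X * A) * (Y * A))" using 4 by metis
  also have "\<dots> = (Y * A) * (X * A)"
    using transpose_mult[OF XA YA] 4 Y by simp
  also have "\<dots> = Y * A"
    using 1 assoc_mult_mat[OF A X A] assoc_mult_mat[OF Yc A XA] by simp
  finally have XAY: "X * A = Y * A" .
  have "Y = Y * A * Y" using Y by simp
  also have "\<dots> = X * A * Y" using XAY by simp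
  also have "\<dots> = X * (A * Y)" using assoc_mult_mat[OF X A Yc] .
  also have "\<dots> = X * (A * X)" using AXY by simp
  also have "\<dots> = X * A * X" using assoc_mult_mat[OF X A X] by simp
  finally show "Y = X" using 2 by simp
qed

lemma sketch_apply_compression:
  assumes "linear Z"
  shows "sketch_apply S (compression Z S *\<^sub>v sketch_transpose_apply S w) = frame_op S (Z (frame_op S w))"
proof -
  have "vec_index (compression Z S *\<^sub>v sketch_transpose_apply S w) i = S ! i \<bullet> Z (frame_op S w)"
    if "i < length S" for i
    unfolding frame_op_def linear_sum[OF assms] inner_sum_right
    using that by (auto simp: compression_def sketch_transpose_apply_def scalar_prod_def lessThan_atLeast0
        linear_scale[OF assms] intro!: sum.cong)
  then show ?thesis unfolding sketch_apply_def by (simp add: frame_op_def)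
qed

lemma scalar_prod_sketch_transpose:
  assumes "y \<in> carrier_vec (length S)"
  shows "scalar_prod (sketch_transpose_apply S w) y = w \<bullet> sketch_apply S y"
  using assms unfolding scalar_prod_def sketch_apply_def sketch_transpose_apply_def inner_sum_right
  by (auto simp: lessThan_atLeast0 inner_commute intro!: sum.cong)

text \<open>
  Let \<open>E\<close> be the \<open>H\<close>-orthogonal projection onto the range of \<open>S\<close> and \<open>N = S S\<^sup>T H\<close>. The map \<open>N\<close> is
  \<open>H\<close>-self-adjoint, maps into the range of \<open>S\<close>, is injective there and vanishes on the
  \<open>H\<close>-orthogonal complement, so \<open>M = N + (I - E)\<close> is invertible. Its inverse \<open>R\<close> commutes with \<open>E\<close> and
  satisfies \<open>R N = N R = E\<close>. With it the Penrose equations for \<open>S\<^sup>T H S\<close> can be solved explicitly: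
  \<open>S\<^sup>T (H R R) S\<close> is the pseudoinverse, and \<open>E\<close> is the resulting sketched projection.
\<close>
lemma pinv_compression:
  fixes H :: "real^'d^'d" and S :: "'d sketch"
  assumes pd: "positive_definite H"
  shows "\<exists>Z E. pinv (compression ((*v) H) S) = compression Z S \<and> linear Z \<and> linear E \<and>
    (\<forall>v. frame_op S (Z (frame_op S (H *v v))) = E v) \<and> (\<forall>s\<in>set S. E s = s) \<and>
    (\<forall>v. E v \<in> span (set S)) \<and> (\<forall>u w. (H *v E u) \<bullet> w = (H *v u) \<bullet> E w)"
proof -
  obtain rs where fix': "\<And>t. t \<in> set S \<Longrightarrow> (\<Sum>r\<leftarrow>rs. (r \<bullet> (H *v t)) *\<^sub>R r) = t"
    and in': "\<And>v. (\<Sum>r\<leftarrow>rs. (r \<bullet> (H *v v)) *\<^sub>R r) \<in> span (set S)"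
    using gram_schmidt[OF pd, of S] by blast
  define E where "E v = (\<Sum>r\<leftarrow>rs. (r \<bullet> (H *v v)) *\<^sub>R r)" for v
  have linE: "linear E" unfolding E_def by (rule linear_frame_sum)
  have sa: "(H *v E u) \<bullet> w = (H *v u) \<bullet> E w" for u w
    unfolding E_def by (rule frame_sum_selfadjoint[OF pd])
  have E_fix: "E t = t" if "t \<in> set S" for t using fix' that by (simp add: E_def)
  have E_in: "E v \<in> span (set S)" for v using in' by (simp add: E_def)
  have E_span: "E t = t" if "t \<in> span (set S)" for t
    using linear_eq_on[OF linE linear_ident that] E_fix by auto
  let ?C = "frame_op S"
  define N where "N v = ?C (H *v v)" for v
  have linH: "linear ((*v) H)" by (rule matrix_vector_mul_linear)
  have linN: "linear N" unfolding N_def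
    using linear_compose[OF linH linear_frame_op, of S] by (simp add: o_def)
  have EN: "E (N v) = N v" for v unfolding N_def by (simp add: E_span frame_op_in_span)
  have symH: "(H *v u) \<bullet> w = (H *v w) \<bullet> u" for u w by (rule positive_definite_sym[OF pd])
  have HN: "(H *v N u) \<bullet> w = (H *v u) \<bullet> N w" for u w
    using symH[of "N u" w] frame_op_sym[of S "H *v w" "H *v u"] by (simp add: N_def inner_commute)
  have NE: "N (E v) = N v" for v
  proof -
    have "(H *v (N (E v) - N v)) \<bullet> w = 0" for w
      by (simp add: matrix_vector_mult_diff_distrib inner_diff_left HN sa EN)
    then have "N (E v) - N v = 0" by (rule positive_definite_eq_0[OF pd])
    then show ?thesis by simp
  qed
  define M where "M v = N v + (v - E v)" for v
  have linM: "linear M" unfolding M_def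
    by (intro linear_compose_add linear_compose_sub linN linE linear_ident)
  have EM: "E (M v) = N v" for v
    by (simp add: M_def linear_add[OF linE] linear_diff[OF linE] EN E_span E_in)
  have ME: "M (E v) = N v" for v
    by (simp add: M_def E_span E_in NE)
  \<comment> \<open>On the kernel of \<open>M\<close> the vector lies in the range of \<open>S\<close> and \<open>S\<^sup>T H v = 0\<close>, so it is \<open>H\<close>-orthogonal to itself.\<close>
  have "inj M"
  proof (subst linear_injective_0[OF linM], intro allI impI)
    fix v assume v: "M v = 0"
    then have N0: "N v = 0" using EM[of v] by (simp add: linear_0[OF linE])
    with v have Ev: "E v = v" by (simp add: M_def)
    have "(H *v v) \<bullet> N v = (\<Sum>i<length S. (S ! i \<bullet> (H *v v))\<^sup>2)"
      unfolding N_def frame_op_def inner_sum_right by (simp add: power2_eq_square inner_commute)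
    then have "\<forall>i<length S. S ! i \<bullet> (H *v v) = 0"
      using N0 by (simp add: sum_nonneg_eq_0_iff)
    then have "s \<bullet> (H *v v) = 0" if "s \<in> set S" for s
      using that by (auto simp: in_set_conv_nth)
    then have "real_inner_class.orthogonal (H *v v) v"
      using E_in[of v] unfolding Ev
      by (intro orthogonal_to_span[of v "set S"]) (auto simp: real_inner_class.orthogonal_def inner_commute)
    then have "v \<bullet> (H *v v) = 0" by (simp add: real_inner_class.orthogonal_def inner_commute)
    then show "v = 0" by (intro positive_definite_eq_0[OF pd]) (simp add: inner_commute)
  qed
  then have "\<exists>R. linear R \<and> (\<forall>v. R (M v) = v) \<and> (\<forall>v. M (R v) = v)"
    by (rule linear_injective_isomorphism[OF linM]) (rule refl)
  then obtain R where R: "linear R \<and> (\<forall>v. R (M v) = v) \<and> (\<forall>v. M (R v) = v)" ..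
  have linR: "linear R" and RM: "\<And>v. R (M v) = v" and MR: "\<And>v. M (R v) = v"
    using R by simp_all
  have RN: "R (N v) = E v" for v using RM[of "E v"] ME by simp
  have ER: "E (R v) = R (E v)" for v
  proof -
    have "M (E (R v)) = N (R v)" by (rule ME)
    also have "\<dots> = E (M (R v))" using EM by simp
    also have "\<dots> = E v" by (simp add: MR)
    finally have "R (M (E (R v))) = R (E v)" by simp
    then show ?thesis by (simp add: RM)
  qed
  have NR: "N (R v) = E v" for v using EM[of "R v"] MR[of v] by simp
  have HR: "(H *v R u) \<bullet> w = (H *v u) \<bullet> R w" for u w
  proof -
    have HM: "(H *v M a) \<bullet> b = (H *v a) \<bullet> M b" for a b
      by (simp add: M_def matrix_vector_right_distrib matrix_vector_mult_diff_distrib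
          inner_add_left inner_add_right inner_diff_left inner_diff_right HN sa)
    have "(H *v R u) \<bullet> w = (H *v R u) \<bullet> M (R w)" by (simp add: MR)
    also have "\<dots> = (H *v M (R u)) \<bullet> R w" by (simp add: HM)
    finally show ?thesis by (simp add: MR)
  qed
  define Z where "Z v = H *v R (R v)" for v
  have linHR: "linear (\<lambda>v. H *v R v)" using linear_compose[OF linR linH] by (simp add: o_def)
  have linZ: "linear Z" unfolding Z_def using linear_compose[OF linR linHR] by (simp add: o_def)
  let ?G = "compression ((*v) H) S" and ?X = "compression Z S"
  have GX: "?G * ?X = compression (\<lambda>v. H *v R v) S"
    unfolding compression_mult[OF linH]
    by (rule compression_cong) (simp add: Z_def N_def[symmetric] NR ER E_fix)
  have XG: "?X * ?G = compression (\<lambda>v. H *v R v) S"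
    unfolding compression_mult[OF linZ]
    by (rule compression_cong) (simp add: Z_def N_def[symmetric] RN E_fix)
  have "compression (\<lambda>v. H *v R v) S * ?G = ?G"
    unfolding compression_mult[OF linHR]
    by (rule compression_cong) (simp add: N_def[symmetric] RN E_fix)
  moreover have "compression (\<lambda>v. H *v R v) S * ?X = ?X"
    unfolding compression_mult[OF linHR]
    by (rule compression_cong) (simp add: Z_def N_def[symmetric] NR ER E_fix)
  moreover have "transpose_mat (compression (\<lambda>v. H *v R v) S) = compression (\<lambda>v. H *v R v) S"
    by (rule compression_transpose) (use HR symH in \<open>simp add: inner_commute\<close>)
  ultimately have "pinv ?G = ?X"
    by (intro pinv_eqI[of _ "length S" "length S"]) (auto simp: GX XG)
  moreover have "?C (Z (?C (H *v v))) = E v" for v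
    by (simp add: Z_def N_def[symmetric] RN NR ER E_span E_in)
  ultimately show ?thesis using linZ linE E_fix E_in sa
    by (intro exI[of _ Z] exI[of _ E]) simp
qed

lemma sketch_hess_eq: "sketch_hess f S x = compression ((*v) (hess f x)) S"
  by (simp add: sketch_hess_def compression_def)

text \<open>
  The sketched projection is the orthogonal projection onto the range of the sketch for the inner
  product of the Hessian, the sketched Newton direction is the projection of the Newton direction,
  and the sketched dual norm of the gradient is the local norm of that direction. Nothing below
  returns to the pseudoinverse.
\<close>
lemma
  fixes f :: "real^'d \<Rightarrow> real"
  assumes pd: "positive_definite (hess f x)"
  shows sketch_proj_span: "s \<in> span (set S) \<Longrightarrow> sketch_proj f S x *v s = s"
    and sketch_proj_in_span: "sketch_proj f S x *v v \<in> span (set S)"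
    and sketch_proj_selfadjoint:
      "(hess f x *v (sketch_proj f S x *v u)) \<bullet> w = (hess f x *v u) \<bullet> (sketch_proj f S x *v w)"
    and sketch_newton_direction: "hess f x *v n = grad f x \<Longrightarrow>
      sketch_apply S (pinv (sketch_hess f S x) *\<^sub>v sketch_grad f S x) = sketch_proj f S x *v n"
    and sketch_dual_norm_eq: "hess f x *v n = grad f x \<Longrightarrow>
      sketch_dual_norm f x S (sketch_grad f S x) = local_norm f x (sketch_proj f S x *v n)"
proof -
  obtain Z E where p: "pinv (sketch_hess f S x) = compression Z S" and linZ: "linear Z" and linE: "linear E"
    and CZC: "\<And>v. frame_op S (Z (frame_op S (hess f x *v v))) = E v"
    and E_fix: "\<And>s. s \<in> set S \<Longrightarrow> E s = s" and E_in: "\<And>v. E v \<in> span (set S)"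
    and sa: "\<And>u w. (hess f x *v E u) \<bullet> w = (hess f x *v u) \<bullet> E w"
    using pinv_compression[OF pd, of S] unfolding sketch_hess_eq by (elim exE conjE) simp
  have P: "sketch_proj f S x *v v = E v" for v
    unfolding sketch_proj_def p sketch_apply_compression[OF linZ] CZC
    using matrix_works[of E] linE by simp
  show 1: "sketch_proj f S x *v s = s" if "s \<in> span (set S)" for s
    unfolding P using linear_eq_on[OF linE linear_ident that] E_fix by auto
  show 2: "sketch_proj f S x *v v \<in> span (set S)" for v unfolding P by (rule E_in)
  show 3: "(hess f x *v (sketch_proj f S x *v u)) \<bullet> w = (hess f x *v u) \<bullet> (sketch_proj f S x *v w)" for u w
    unfolding P by (rule sa)
  assume n: "hess f x *v n = grad f x"
  show 4: "sketch_apply S (pinv (sketch_hess f S x) *\<^sub>v sketch_grad f S x) = sketch_proj f S x *v n"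
    unfolding p sketch_grad_def sketch_apply_compression[OF linZ] n[symmetric] CZC P ..
  have carr: "pinv (sketch_hess f S x) *\<^sub>v sketch_grad f S x \<in> carrier_vec (length S)"
    unfolding p by (rule mult_mat_vec_carrier[OF compression_carrier])
      (simp add: sketch_grad_def sketch_transpose_apply_def)
  have "scalar_prod (sketch_grad f S x) (pinv (sketch_hess f S x) *\<^sub>v sketch_grad f S x)
      = grad f x \<bullet> sketch_apply S (pinv (sketch_hess f S x) *\<^sub>v sketch_grad f S x)"
    using scalar_prod_sketch_transpose[OF carr, of "grad f x"] by (simp only: sketch_grad_def)
  also have "\<dots> = (hess f x *v n) \<bullet> (sketch_proj f S x *v n)"
    by (simp only: 4 n)
  also have "\<dots> = (hess f x *v n) \<bullet> (sketch_proj f S x *v (sketch_proj f S x *v n))"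
    by (simp only: 1[OF 2])
  also have "\<dots> = (hess f x *v (sketch_proj f S x *v n)) \<bullet> (sketch_proj f S x *v n)"
    by (rule 3[symmetric])
  finally show "sketch_dual_norm f x S (sketch_grad f S x) = local_norm f x (sketch_proj f S x *v n)"
    by (simp only: sketch_dual_norm_def local_norm_def)
qed

section \<open>Derivatives along lines and local norms\<close>

locale positive_definite_hessian =
  fixes f :: "real^'d \<Rightarrow> real"
  assumes smooth: "thrice_differentiable f"
    and hess_pd: "\<And>x. positive_definite (hess f x)"
begin

lemma has_derivative_grad_inner: "(f has_derivative (\<lambda>h. h \<bullet> grad f x)) (at x)"
proof -
  obtain D where D: "(f has_derivative D) (at x)"
    using smooth unfolding thrice_differentiable_def differentiable_def by blast
  define g where "g = (\<Sum>i\<in>Basis. D i *\<^sub>R i)"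
  have "D h = h \<bullet> g" for h
  proof -
    interpret bounded_linear D by (rule has_derivative_bounded_linear[OF D])
    have "D h = D (\<Sum>i\<in>Basis. (h \<bullet> i) *\<^sub>R i)" by (simp add: euclidean_representation)
    also have "\<dots> = h \<bullet> g" by (simp add: g_def sum scale inner_sum_right mult.commute)
    finally show ?thesis .
  qed
  then have g: "GDERIV f x :> g" using D unfolding gderiv_def by presburger
  have "g' = g" if "GDERIV f x :> g'" for g'
  proof -
    have "(\<lambda>h. h \<bullet> g') = (\<lambda>h. h \<bullet> g)"
      using that g unfolding gderiv_def by (rule has_derivative_unique)
    then have "(g' - g) \<bullet> (g' - g) = 0" by (metis diff_self inner_diff_right)
    then show ?thesis by simp
  qed
  with g have "grad f x = g" unfolding grad_def by (intro the_equality)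
  with g show ?thesis by (simp add: gderiv_def)
qed

lemma has_derivative_hess: "(grad f has_derivative (\<lambda>h. hess f x *v h)) (at x)"
  using smooth unfolding thrice_differentiable_def hess_def jacobian_works by blast

lemma continuous_f: "continuous_on A f"
  by (rule continuous_at_imp_continuous_on) (use has_derivative_continuous[OF has_derivative_grad_inner] in blast)

lemma continuous_grad: "continuous_on A (grad f)"
  by (rule continuous_at_imp_continuous_on) (use has_derivative_continuous[OF has_derivative_hess] in blast)

lemma continuous_hess: "continuous_on A (hess f)"
  by (rule continuous_at_imp_continuous_on)
    (use smooth in \<open>auto simp: thrice_differentiable_def intro: differentiable_imp_continuous_within\<close>)

lemma line_derivative:
  assumes "(s has_real_derivative s') (at t)"
  shows "((\<lambda>t. f (x + s t *\<^sub>R h)) has_real_derivative s' * (grad f (x + s t *\<^sub>R h) \<bullet> h)) (at t)"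
proof -
  have s: "(s has_derivative (\<lambda>d. d * s')) (at t)"
    using assms by (simp add: has_field_derivative_def mult_commute_abs)
  have "((\<lambda>t. x + s t *\<^sub>R h) has_derivative (\<lambda>d. (d * s') *\<^sub>R h)) (at t)"
    using s by (auto intro!: derivative_eq_intros)
  from has_derivative_compose[OF this has_derivative_grad_inner]
  show ?thesis
    by (simp add: has_field_derivative_def inner_commute mult_commute_abs mult.assoc)
qed

lemma line_derivative_grad:
  assumes "(s has_real_derivative s') (at t)"
  shows "((\<lambda>t. grad f (x + s t *\<^sub>R h) \<bullet> w) has_real_derivative
    s' * ((hess f (x + s t *\<^sub>R h) *v h) \<bullet> w)) (at t)"
proof -
  have s: "(s has_derivative (\<lambda>d. d * s')) (at t)"
    using assms by (simp add: has_field_derivative_def mult_commute_abs)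
  have "((\<lambda>t. x + s t *\<^sub>R h) has_derivative (\<lambda>d. (d * s') *\<^sub>R h)) (at t)"
    using s by (auto intro!: derivative_eq_intros)
  from has_derivative_inner_left[OF has_derivative_compose[OF this has_derivative_hess], of w]
  show ?thesis
    by (simp add: has_field_derivative_def matrix_vector_mult_scaleR mult_commute_abs mult.assoc)
qed

lemma local_norm_nonneg [simp]: "0 \<le> local_norm f x h"
  by (simp add: local_norm_def positive_definite_nonneg[OF hess_pd])

lemma local_norm_power2: "(local_norm f x h)\<^sup>2 = (hess f x *v h) \<bullet> h"
  by (simp add: local_norm_def positive_definite_nonneg[OF hess_pd])

lemma local_norm_pos: "h \<noteq> 0 \<Longrightarrow> 0 < local_norm f x h"
  using hess_pd[of x] by (simp add: local_norm_def positive_definite_def)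

lemma local_norm_scaleR: "local_norm f x (c *\<^sub>R h) = \<bar>c\<bar> * local_norm f x h"
  by (simp add: local_norm_def matrix_vector_mult_scaleR real_sqrt_mult flip: mult.assoc)

lemma local_Cauchy_Schwarz:
  "\<bar>(hess f x *v u) \<bullet> v\<bar> \<le> local_norm f x u * local_norm f x v"
proof (cases "v = 0")
  case True
  then show ?thesis by simp
next
  case False
  define N where "N = (hess f x *v v) \<bullet> v"
  define B where "B = (hess f x *v u) \<bullet> v"
  have N: "N > 0" using hess_pd[of x] False by (simp add: N_def positive_definite_def)
  have B': "(hess f x *v v) \<bullet> u = B"
    unfolding B_def by (rule positive_definite_sym[OF hess_pd])
  have "0 \<le> (hess f x *v (u - (B / N) *\<^sub>R v)) \<bullet> (u - (B / N) *\<^sub>R v)"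
    by (rule positive_definite_nonneg[OF hess_pd])
  also have "\<dots> = (hess f x *v u) \<bullet> u - B\<^sup>2 / N"
    using N by (simp add: matrix_vector_mult_diff_distrib matrix_vector_mult_scaleR inner_diff_left
        inner_diff_right B' B_def[symmetric] N_def[symmetric] power2_eq_square)
  finally have "B\<^sup>2 \<le> (hess f x *v u) \<bullet> u * N" using N by (simp add: field_simps)
  then have "sqrt (B\<^sup>2) \<le> sqrt ((hess f x *v u) \<bullet> u * N)" by (rule real_sqrt_le_mono)
  then show ?thesis by (simp add: B_def N_def local_norm_def real_sqrt_mult)
qed

lemma hess_matrix_inv: "hess f x *v (matrix_inv (hess f x) *v v) = v"
proof -
  have "\<exists>B. B ** hess f x = Finite_Cartesian_Product.mat 1"
    unfolding matrix_left_invertible_ker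
    using positive_definite_eq_0[OF hess_pd[of x]] by (metis inner_zero_left)
  then have "invertible (hess f x)" by (simp add: invertible_left_inverse)
  then have "hess f x ** matrix_inv (hess f x) = Finite_Cartesian_Product.mat 1"
    unfolding invertible_def matrix_inv_def by (rule someI2_ex) simp
  then show ?thesis by (simp add: matrix_vector_mul_assoc)
qed

section \<open>Models of semi-strongly self-concordant functions\<close>

text \<open>
  Writing the Hessian difference applied to \<open>v\<close> as \<open>H\<^sub>x z\<close>, its dual norm is the local norm of \<open>z\<close>, and
  Cauchy--Schwarz turns the operator norm bound into a bound for the quadratic form.
\<close>
lemma semi_strong_quadratic_form:
  assumes "semi_strongly_self_concordant L f"
  shows "\<bar>(hess f y *v v) \<bullet> v - (hess f x *v v) \<bullet> v\<bar>
    \<le> L * local_norm f x (y - x) * (local_norm f x v)\<^sup>2"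
proof (cases "v = 0")
  case True
  then show ?thesis by (simp add: local_norm_def)
next
  case False
  define w where "w = (hess f y - hess f x) *v v"
  define z where "z = matrix_inv (hess f x) *v w"
  have Hz: "hess f x *v z = w" unfolding z_def by (rule hess_matrix_inv)
  have "(SUP v\<in>{v. v \<noteq> 0}. ereal (local_dual_norm f x ((hess f y - hess f x) *v v) / local_norm f x v))
      \<le> ereal (L * local_norm f x (y - x))"
    using assms unfolding semi_strongly_self_concordant_def by blast
  with False have "ereal (local_dual_norm f x w / local_norm f x v) \<le> ereal (L * local_norm f x (y - x))"
    unfolding w_def SUP_le_iff by blast
  then have "local_dual_norm f x w \<le> L * local_norm f x (y - x) * local_norm f x v"
    using local_norm_pos[OF False] by (simp add: pos_divide_le_eq)
  moreover have "local_dual_norm f x w = local_norm f x z"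
    by (simp add: local_dual_norm_def local_norm_def Hz flip: z_def)
  ultimately have "local_norm f x z * local_norm f x v
      \<le> L * local_norm f x (y - x) * local_norm f x v * local_norm f x v"
    by (intro mult_right_mono) auto
  moreover have "\<bar>w \<bullet> v\<bar> \<le> local_norm f x z * local_norm f x v"
    using local_Cauchy_Schwarz[of x z v] by (simp add: Hz)
  ultimately show ?thesis
    by (simp add: w_def matrix_vector_mult_diff_rdistrib inner_diff_left power2_eq_square mult.assoc)
qed

lemma semi_strong_upper_model:
  assumes L: "semi_strongly_self_concordant L f" and L0: "0 < L"
  shows "f (x + h) \<le> f x + grad f x \<bullet> h + (local_norm f x h)\<^sup>2 / 2 + L * (local_norm f x h) ^ 3 / 6"
proof -
  define \<rho> where "\<rho> = local_norm f x h"
  have H: "(hess f (x + t *\<^sub>R h) *v h) \<bullet> h \<le> \<rho>\<^sup>2 + L * \<rho> ^ 3 * t" if "0 \<le> t" for t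
    using semi_strong_quadratic_form[OF L, of "x + t *\<^sub>R h" h x] that
    by (simp add: local_norm_power2[symmetric] \<rho>_def[symmetric] local_norm_scaleR power3_eq_cube
        power2_eq_square algebra_simps)
  have G: "grad f (x + t *\<^sub>R h) \<bullet> h \<le> grad f x \<bullet> h + \<rho>\<^sup>2 * t + L * \<rho> ^ 3 * t\<^sup>2 / 2" if t: "0 \<le> t" for t
  proof -
    let ?D = "\<lambda>t. \<rho>\<^sup>2 * t + L * \<rho> ^ 3 * t\<^sup>2 / 2 - grad f (x + t *\<^sub>R h) \<bullet> h"
    have "?D 0 \<le> ?D t"
    proof (rule DERIV_nonneg_imp_nondecreasing[OF t])
      fix r :: real assume "0 \<le> r"
      have "(?D has_real_derivative \<rho>\<^sup>2 + L * \<rho> ^ 3 * r - (hess f (x + r *\<^sub>R h) *v h) \<bullet> h) (at r)"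
        by (auto intro!: derivative_eq_intros line_derivative_grad[where s' = 1, simplified])
      with H[OF \<open>0 \<le> r\<close>] show "\<exists>y. (?D has_real_derivative y) (at r) \<and> 0 \<le> y" by force
    qed
    then show ?thesis by simp
  qed
  let ?D = "\<lambda>t. (grad f x \<bullet> h) * t + \<rho>\<^sup>2 * t\<^sup>2 / 2 + L * \<rho> ^ 3 * t ^ 3 / 6 - f (x + t *\<^sub>R h)"
  have "?D 0 \<le> ?D 1"
  proof (rule DERIV_nonneg_imp_nondecreasing[of 0 1 ?D])
    fix r :: real assume "0 \<le> r"
    have "(?D has_real_derivative grad f x \<bullet> h + \<rho>\<^sup>2 * r + L * \<rho> ^ 3 * r\<^sup>2 / 2 - grad f (x + r *\<^sub>R h) \<bullet> h) (at r)"
      by (auto intro!: derivative_eq_intros line_derivative[where s' = 1, simplified])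
    with G[OF \<open>0 \<le> r\<close>] show "\<exists>y. (?D has_real_derivative y) (at r) \<and> 0 \<le> y" by force
  qed simp
  then show ?thesis by (simp add: \<rho>_def)
qed

text \<open>
  Let \<open>\<rho>\<close> and \<open>\<sigma>\<close> be the local norms of \<open>h\<close> at \<open>x\<close> and at \<open>x + s h\<close>. Semi-strong self-concordance is not
  symmetric in its two points, and the bound based at the far point is the useful one:
  \<open>\<rho>\<^sup>2 \<le> \<sigma>\<^sup>2 + L s \<sigma>\<^sup>3\<close>. Thus the curvature decays at most like \<open>s\<close> to the power \<open>-2/3\<close>, slower than the
  rate \<open>1/s\<^sup>2\<close> that self-concordance alone permits. The parameter \<open>z\<close> with \<open>z\<^sup>3 = 1 + 3 L \<rho> s / 2\<close> makes
  the bound rational; it reduces to \<open>(z - 1)\<^sup>2 (z + 2) \<ge> 0\<close>.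
\<close>
lemma semi_strong_curvature_decay:
  assumes L: "semi_strongly_self_concordant L f" and L0: "0 < L"
    and \<rho>: "0 < local_norm f x h" and z: "1 \<le> z"
    and s: "s = 2 / 3 * (z ^ 3 - 1) / (L * local_norm f x h)"
  shows "(local_norm f x h)\<^sup>2 / z\<^sup>2 \<le> (hess f (x + s *\<^sub>R h) *v h) \<bullet> h"
proof -
  define \<rho> where "\<rho> = local_norm f x h"
  define \<sigma> where "\<sigma> = local_norm f (x + s *\<^sub>R h) h"
  have \<rho>0: "0 < \<rho>" using \<rho> by (simp add: \<rho>_def)
  have s0: "0 \<le> s" unfolding s using L0 \<rho> z by simp
  have "\<rho>\<^sup>2 \<le> \<sigma>\<^sup>2 + L * s * \<sigma> ^ 3"
    using semi_strong_quadratic_form[OF L, of x h "x + s *\<^sub>R h"] s0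
      local_norm_scaleR[of "x + s *\<^sub>R h" "- s" h]
    by (simp add: local_norm_power2[symmetric] \<rho>_def[symmetric] \<sigma>_def[symmetric]
        power3_eq_cube power2_eq_square algebra_simps)
  have "\<rho> / z \<le> \<sigma>"
  proof (rule ccontr)
    assume "\<not> \<rho> / z \<le> \<sigma>"
    then have lt: "\<sigma> < \<rho> / z" by simp
    have \<sigma>0: "0 \<le> \<sigma>" by (simp add: \<sigma>_def)
    have "\<sigma>\<^sup>2 < (\<rho> / z)\<^sup>2" using lt \<sigma>0 by (intro power_strict_mono) auto
    moreover have "L * s * \<sigma> ^ 3 \<le> L * s * (\<rho> / z) ^ 3"
      using lt \<sigma>0 s0 L0 by (intro mult_left_mono power_mono) auto
    moreover have "L * s * (\<rho> / z) ^ 3 = \<rho>\<^sup>2 * (2 / 3 * (z ^ 3 - 1) / z ^ 3)"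
      unfolding s using L0 \<rho>0 z
      by (simp add: \<rho>_def[symmetric] field_simps power3_eq_cube power2_eq_square)
    moreover have "1 / z\<^sup>2 + 2 / 3 * (z ^ 3 - 1) / z ^ 3 \<le> 1"
    proof -
      have "0 \<le> (z - 1)\<^sup>2 * (z + 2)" using z by simp
      then have "3 * z + 2 * (z ^ 3 - 1) \<le> 3 * z ^ 3"
        by (simp add: power2_eq_square power3_eq_cube algebra_simps)
      then have "(3 * z + 2 * (z ^ 3 - 1)) / (3 * z ^ 3) \<le> 1" using z by simp
      moreover have "1 / z\<^sup>2 + 2 / 3 * (z ^ 3 - 1) / z ^ 3 = (3 * z + 2 * (z ^ 3 - 1)) / (3 * z ^ 3)"
        using z by (simp add: divide_simps) (simp add: power2_eq_square power3_eq_cube algebra_simps)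
      ultimately show ?thesis by simp
    qed
    then have "\<rho>\<^sup>2 * (1 / z\<^sup>2 + 2 / 3 * (z ^ 3 - 1) / z ^ 3) \<le> \<rho>\<^sup>2 * 1" by (intro mult_left_mono) auto
    then have "(\<rho> / z)\<^sup>2 + \<rho>\<^sup>2 * (2 / 3 * (z ^ 3 - 1) / z ^ 3) \<le> \<rho>\<^sup>2"
      by (simp add: power_divide distrib_left)
    ultimately show False using \<open>\<rho>\<^sup>2 \<le> \<sigma>\<^sup>2 + L * s * \<sigma> ^ 3\<close> by linarith
  qed
  then have "(\<rho> / z)\<^sup>2 \<le> \<sigma>\<^sup>2" using \<rho>0 z by (intro power_mono) auto
  then show ?thesis by (simp add: power_divide \<rho>_def \<sigma>_def local_norm_power2)
qed

end

text \<open>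
  The quartic is minimal over \<open>z > 0\<close> at \<open>m = 1 + p/2\<close>. Its distance from the minimum contains the
  factor \<open>(z - m)\<^sup>2\<close>, and the minimum is \<open>-p\<^sup>2 (6 + 2 p + p\<^sup>2/4) / 12\<close>, which is at least \<open>-11/16 p\<^sup>2\<close>.
\<close>
lemma quartic_lower_bound:
  fixes p z :: real
  assumes p: "0 \<le> p" "p \<le> 1"
  shows "- (17 / 24 * p\<^sup>2) \<le> z ^ 4 - 1 - 2 / 3 * (2 + p) * (z ^ 3 - 1)"
proof -
  define m where "m = 1 + p / 2"
  have "z\<^sup>2 + 2 / 3 * m * z + m\<^sup>2 / 3 = (z + m / 3)\<^sup>2 + 2 / 9 * m\<^sup>2"
    by (simp add: power2_eq_square algebra_simps)
  then have "0 \<le> (z - m)\<^sup>2 * (z\<^sup>2 + 2 / 3 * m * z + m\<^sup>2 / 3)" by simp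
  also have "\<dots> = z ^ 4 - 4 / 3 * m * z ^ 3 + m ^ 4 / 3"
    by (simp add: power2_eq_square power3_eq_cube power4_eq_xxxx algebra_simps add_divide_distrib)
  finally have 1: "0 \<le> z ^ 4 - 4 / 3 * m * z ^ 3 + m ^ 4 / 3" .
  have "p\<^sup>2 * (2 * p + p\<^sup>2 / 4) \<le> p\<^sup>2 * (5 / 2)"
    using p power_le_one[of p 2] by (intro mult_left_mono) auto
  moreover have "m ^ 4 / 3 - 4 / 3 * m + 1 = p\<^sup>2 * (6 + 2 * p + p\<^sup>2 / 4) / 12"
    by (simp add: m_def power2_eq_square power4_eq_xxxx algebra_simps add_divide_distrib)
  ultimately have "m ^ 4 / 3 - 4 / 3 * m + 1 \<le> 17 / 24 * p\<^sup>2"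
    by (simp add: distrib_left)
  moreover have "2 / 3 * (2 + p) * (z ^ 3 - 1) = 4 / 3 * m * z ^ 3 - 4 / 3 * m"
    by (simp add: m_def algebra_simps add_divide_distrib diff_divide_distrib)
  ultimately show ?thesis using 1 by linarith
qed

context positive_definite_hessian
begin

text \<open>
  How much \<open>f\<close> can decrease in a direction in which the slope is at least \<open>-\<gamma>\<close> per unit of local
  length. For a quadratic the answer would be \<open>\<gamma>\<^sup>2/2\<close>. Integrating the curvature bound twice in the
  parameter \<open>z\<close> leaves a polynomial, and \<open>L \<gamma> \<le> 1\<close> keeps its minimum above \<open>-17/24 \<gamma>\<^sup>2\<close>.
\<close>
lemma semi_strong_lower_bound:
  assumes L: "semi_strongly_self_concordant L f" and L0: "0 < L"
    and \<gamma>: "0 \<le> \<gamma>" "L * \<gamma> \<le> 1" and g: "- (\<gamma> * local_norm f x h) \<le> grad f x \<bullet> h"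
  shows "f x - f (x + h) \<le> 17 / 24 * \<gamma>\<^sup>2"
proof (cases "h = 0")
  case True
  then show ?thesis by simp
next
  case False
  define \<rho> where "\<rho> = local_norm f x h"
  have \<rho>: "0 < \<rho>" unfolding \<rho>_def using False by (rule local_norm_pos)
  define s where "s z = 2 / 3 * (z ^ 3 - 1) / (L * \<rho>)" for z :: real
  have s': "(s has_real_derivative 2 * z\<^sup>2 / (L * \<rho>)) (at z)" for z
    unfolding s_def using L0 \<rho> by (auto intro!: derivative_eq_intros)
  define p where "p = L * \<gamma>"
  \<comment> \<open>In the parameter \<open>z\<close> the slope along \<open>h\<close> grows at least linearly.\<close>
  have A: "- (\<gamma> * \<rho>) + 2 * \<rho> / L * (z - 1) \<le> grad f (x + s z *\<^sub>R h) \<bullet> h" if z: "1 \<le> z" for z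
  proof -
    let ?D = "\<lambda>z. grad f (x + s z *\<^sub>R h) \<bullet> h - 2 * \<rho> / L * (z - 1)"
    have "?D 1 \<le> ?D z"
    proof (rule DERIV_nonneg_imp_nondecreasing[OF z])
      fix r :: real assume r: "1 \<le> r"
      have "(?D has_real_derivative 2 * r\<^sup>2 / (L * \<rho>) * ((hess f (x + s r *\<^sub>R h) *v h) \<bullet> h) - 2 * \<rho> / L) (at r)"
        using L0 by (auto intro!: derivative_eq_intros line_derivative_grad[OF s'])
      moreover have "2 * r\<^sup>2 / (L * \<rho>) * (\<rho>\<^sup>2 / r\<^sup>2) \<le> 2 * r\<^sup>2 / (L * \<rho>) * ((hess f (x + s r *\<^sub>R h) *v h) \<bullet> h)"
        using semi_strong_curvature_decay[OF L L0, of x h r "s r"] \<rho> L0 r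
        by (intro mult_left_mono) (auto simp: s_def \<rho>_def)
      moreover have "2 * r\<^sup>2 / (L * \<rho>) * (\<rho>\<^sup>2 / r\<^sup>2) = 2 * \<rho> / L"
        using \<rho> L0 r by (simp add: field_simps power2_eq_square)
      ultimately show "\<exists>y. (?D has_real_derivative y) (at r) \<and> 0 \<le> y" by force
    qed
    then show ?thesis using g by (simp add: s_def \<rho>_def)
  qed
  define c where "c = 1 / L\<^sup>2"
  have B: "c * (z ^ 4 - 1 - 2 / 3 * (2 + p) * (z ^ 3 - 1)) \<le> f (x + s z *\<^sub>R h) - f x"
    if z: "1 \<le> z" for z
  proof -
    let ?D = "\<lambda>z. f (x + s z *\<^sub>R h) - c * (z ^ 4 - 1 - 2 / 3 * (2 + p) * (z ^ 3 - 1))"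
    have "?D 1 \<le> ?D z"
    proof (rule DERIV_nonneg_imp_nondecreasing[OF z])
      fix r :: real assume r: "1 \<le> r"
      have "(?D has_real_derivative 2 * r\<^sup>2 / (L * \<rho>) * (grad f (x + s r *\<^sub>R h) \<bullet> h)
          - c * (4 * r ^ 3 - 2 / 3 * (2 + p) * (3 * r\<^sup>2))) (at r)"
        by (auto intro!: derivative_eq_intros line_derivative[OF s'])
      moreover have "2 * r\<^sup>2 / (L * \<rho>) * (- (\<gamma> * \<rho>) + 2 * \<rho> / L * (r - 1))
          \<le> 2 * r\<^sup>2 / (L * \<rho>) * (grad f (x + s r *\<^sub>R h) \<bullet> h)"
        using A[OF r] \<rho> L0 by (intro mult_left_mono) auto
      moreover have "2 * r\<^sup>2 / (L * \<rho>) * (- (\<gamma> * \<rho>) + 2 * \<rho> / L * (r - 1))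
          = c * (4 * r ^ 3 - 2 / 3 * (2 + p) * (3 * r\<^sup>2))"
        using \<rho> L0 by (simp add: p_def c_def field_simps) (simp add: power2_eq_square power3_eq_cube algebra_simps)
      ultimately show "\<exists>y. (?D has_real_derivative y) (at r) \<and> 0 \<le> y" by force
    qed
    then show ?thesis by (simp add: s_def)
  qed
  \<comment> \<open>The parameter value that corresponds to the end point \<open>x + h\<close>.\<close>
  define z where "z = root 3 (1 + 3 / 2 * (L * \<rho>))"
  have z3: "z ^ 3 = 1 + 3 / 2 * (L * \<rho>)" unfolding z_def using L0 \<rho> by (intro real_root_pow_pos2) auto
  have z1: "1 \<le> z" unfolding z_def using L0 \<rho> by simp
  have sz: "s z = 1" using L0 \<rho> by (simp add: s_def z3)
  have "c * (- (17 / 24 * p\<^sup>2)) \<le> c * (z ^ 4 - 1 - 2 / 3 * (2 + p) * (z ^ 3 - 1))"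
    using \<gamma> L0 by (intro mult_left_mono quartic_lower_bound) (auto simp: p_def c_def)
  moreover have "c * (- (17 / 24 * p\<^sup>2)) = - (17 / 24 * \<gamma>\<^sup>2)"
    using L0 by (simp add: p_def c_def power_mult_distrib)
  ultimately show ?thesis using B[OF z1] sz by simp
qed

end

section \<open>The decrease of one step\<close>

lemma sgn_stepsize_equation:
  assumes "0 \<le> G"
  shows "0 < sgn_stepsize G" "sgn_stepsize G \<le> 1" "G * (sgn_stepsize G)\<^sup>2 / 2 + sgn_stepsize G = 1"
proof -
  define \<alpha> where "\<alpha> = sgn_stepsize G"
  have "0 < \<alpha> \<and> G * \<alpha>\<^sup>2 / 2 + \<alpha> = 1"
  proof (cases "G = 0")
    case True
    then show ?thesis by (simp add: \<alpha>_def sgn_stepsize_def)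
  next
    case False
    define r where "r = sqrt (1 + 2 * G)"
    have r2: "r\<^sup>2 = 1 + 2 * G" using assms by (simp add: r_def)
    have "1 < r" using assms False by (simp add: r_def)
    have \<alpha>: "\<alpha> = (r - 1) / G" using False by (simp add: \<alpha>_def sgn_stepsize_def r_def)
    have "G * \<alpha>\<^sup>2 / 2 + \<alpha> = (r\<^sup>2 - 1) / (2 * G)"
      using False by (simp add: \<alpha> power2_eq_square field_simps)
    also have "\<dots> = 1" using False by (simp add: r2)
    finally show ?thesis using \<open>1 < r\<close> assms False by (simp add: \<alpha>)
  qed
  moreover have "0 \<le> G * \<alpha>\<^sup>2 / 2" using assms by simp
  ultimately show "0 < sgn_stepsize G" "sgn_stepsize G \<le> 1"
    "G * (sgn_stepsize G)\<^sup>2 / 2 + sgn_stepsize G = 1"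
    unfolding \<alpha>_def[symmetric] by linarith+
qed

text \<open>
  The factor in parentheses is the decrease of the cubic upper model in units of the squared sketched
  gradient norm, for the normalised norm \<open>p\<close> and \<open>\<kappa>\<close> the ratio of the two constants. The product with
  the rate constant \<open>max (sqrt \<kappa>) 2\<close> is smallest at \<open>\<kappa> = 4\<close>, \<open>p = 1\<close>, where \<open>\<alpha> = 1/2\<close> and the value is exactly
  \<open>17/24\<close>. For large \<open>\<alpha>\<close> the step-size equation bounds the cubic term and 2 is used; for small \<open>\<alpha>\<close> it gives
  \<open>sqrt \<kappa> \<ge> 1/\<alpha>\<close>.
\<close>
lemma stepsize_progress_constant:
  assumes p: "0 \<le> p" "p \<le> 1" and \<kappa>: "1 \<le> \<kappa>" and \<alpha>: "\<alpha> = sgn_stepsize (\<kappa> * p)"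
  shows "17 / 24 \<le> max (sqrt \<kappa>) 2 * (\<alpha> - \<alpha>\<^sup>2 / 2 - p * \<alpha> ^ 3 / 6)"
proof -
  have "0 \<le> \<kappa> * p" using p \<kappa> by simp
  from sgn_stepsize_equation[OF this]
  have \<alpha>0: "0 < \<alpha>" and \<alpha>1: "\<alpha> \<le> 1" and eq: "\<kappa> * p * \<alpha>\<^sup>2 / 2 + \<alpha> = 1" unfolding \<alpha> by auto
  have p3: "p * \<alpha> ^ 3 \<le> \<alpha> ^ 3" using p \<alpha>0 by (simp add: mult_left_le_one_le)
  define \<psi> where "\<psi> = \<alpha> - \<alpha>\<^sup>2 / 2 - p * \<alpha> ^ 3 / 6"
  define b where "b = max (sqrt \<kappa>) 2"
  have b2: "2 \<le> b" and bs: "sqrt \<kappa> \<le> b" by (simp_all add: b_def)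
  \<comment> \<open>The split points make each estimate valid on its range; the bound is attained at \<open>\<alpha> = 1/2\<close>.\<close>
  consider "7 / 10 \<le> \<alpha>" | "1 / 2 \<le> \<alpha>" "\<alpha> \<le> 7 / 10" | "\<alpha> \<le> 1 / 2" by linarith
  then have "17 / 24 \<le> b * \<psi>"
  proof cases
    case 1
    have "p * \<alpha>\<^sup>2 \<le> \<kappa> * p * \<alpha>\<^sup>2" using p \<kappa> by (intro mult_right_mono) (auto simp: mult_le_cancel_right1)
    moreover have "\<kappa> * p * \<alpha>\<^sup>2 = 2 * (1 - \<alpha>)" using eq by (simp add: field_simps)
    ultimately have "p * \<alpha>\<^sup>2 \<le> 2 * (1 - \<alpha>)" by simp
    then have "\<alpha> * (p * \<alpha>\<^sup>2) \<le> \<alpha> * (2 * (1 - \<alpha>))" using \<alpha>0 by (intro mult_left_mono) auto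
    then have "p * \<alpha> ^ 3 \<le> 2 * \<alpha> - 2 * \<alpha>\<^sup>2"
      by (simp add: power3_eq_cube power2_eq_square algebra_simps)
    moreover have "0 \<le> (\<alpha> - 7 / 10) * (33 / 10 - \<alpha>)" using 1 \<alpha>1 by simp
    then have "231 / 100 \<le> 4 * \<alpha> - \<alpha>\<^sup>2" by (simp add: power2_eq_square algebra_simps add_divide_distrib diff_divide_distrib)
    ultimately have \<psi>: "17 / 48 \<le> \<psi>" unfolding \<psi>_def by linarith
    have "2 * \<psi> \<le> b * \<psi>" using \<psi> b2 by (intro mult_right_mono) auto
    with \<psi> show ?thesis by linarith
  next
    case 2
    have "\<alpha>\<^sup>2 \<le> (7 / 10)\<^sup>2" using 2 \<alpha>0 by (intro power_mono) auto
    then have "0 \<le> 17 / 24 - 7 / 12 * \<alpha> - \<alpha>\<^sup>2 / 6" using 2 by (simp add: power2_eq_square)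
    then have "0 \<le> (\<alpha> - 1 / 2) * (17 / 24 - 7 / 12 * \<alpha> - \<alpha>\<^sup>2 / 6)"
      using 2 by (intro mult_nonneg_nonneg) auto
    then have "17 / 48 \<le> \<alpha> - \<alpha>\<^sup>2 / 2 - \<alpha> ^ 3 / 6"
      by (simp add: power2_eq_square power3_eq_cube algebra_simps add_divide_distrib diff_divide_distrib)
    then have \<psi>: "17 / 48 \<le> \<psi>" unfolding \<psi>_def using p3 by linarith
    have "2 * \<psi> \<le> b * \<psi>" using \<psi> b2 by (intro mult_right_mono) auto
    with \<psi> show ?thesis by linarith
  next
    case 3
    have "\<kappa> * p * \<alpha>\<^sup>2 \<le> \<kappa> * \<alpha>\<^sup>2" using p \<kappa> by (intro mult_right_mono) (auto simp: mult_left_le)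
    then have "1 \<le> \<kappa> * \<alpha>\<^sup>2" using eq 3 by linarith
    then have "sqrt 1 \<le> sqrt (\<kappa> * \<alpha>\<^sup>2)" by (rule real_sqrt_le_mono)
    then have s: "1 \<le> sqrt \<kappa> * \<alpha>" using \<alpha>0 by (simp add: real_sqrt_mult)
    have "\<alpha>\<^sup>2 \<le> (1 / 2)\<^sup>2" using 3 \<alpha>0 by (intro power_mono) auto
    moreover have "p * \<alpha>\<^sup>2 \<le> \<alpha>\<^sup>2" using p by (simp add: mult_left_le_one_le)
    ultimately have q: "17 / 24 \<le> 1 - \<alpha> / 2 - p * \<alpha>\<^sup>2 / 6" using 3 unfolding power2_eq_square by linarith
    have eq\<psi>: "\<psi> = \<alpha> * (1 - \<alpha> / 2 - p * \<alpha>\<^sup>2 / 6)"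
      by (simp add: \<psi>_def power2_eq_square power3_eq_cube algebra_simps)
    have "17 / 24 \<le> 1 * (1 - \<alpha> / 2 - p * \<alpha>\<^sup>2 / 6)" using q by simp
    also have "\<dots> \<le> (sqrt \<kappa> * \<alpha>) * (1 - \<alpha> / 2 - p * \<alpha>\<^sup>2 / 6)"
      using s q by (intro mult_right_mono) auto
    also have "\<dots> = sqrt \<kappa> * \<psi>" unfolding eq\<psi> by simp
    also have "\<dots> \<le> b * \<psi>"
      unfolding eq\<psi> using q \<alpha>0 bs by (intro mult_right_mono mult_nonneg_nonneg) auto
    finally show ?thesis .
  qed
  then show ?thesis unfolding b_def \<psi>_def .
qed

context positive_definite_hessian
begin

text \<open>
  With \<open>b = max (sqrt (L_alg / L)) 2\<close>, one step achieves the fraction \<open>1/b\<close> of any decrease that is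
  possible within the range of the sketch: both sides are compared with the squared sketched gradient
  norm, and the constants \<open>17/24\<close> of the lower bound and of the step size meet.
\<close>
lemma sgn_step_progress:
  assumes L: "semi_strongly_self_concordant L f" and L0: "0 < L" and L_alg: "L \<le> L_alg"
    and regime: "sketch_dual_norm f x S (sketch_grad f S x) \<le> 1 / L"
    and u: "u \<in> span (set S)"
  shows "f x - f (x + u) \<le> max (sqrt (L_alg / L)) 2 * (f x - f (sgn_step f L_alg S x))"
    and "f (sgn_step f L_alg S x) \<le> f x"
proof -
  let ?P = "sketch_proj f S x"
  define n where "n = matrix_inv (hess f x) *v grad f x"
  have n: "hess f x *v n = grad f x" unfolding n_def by (rule hess_matrix_inv)
  define \<gamma> where "\<gamma> = sketch_dual_norm f x S (sketch_grad f S x)"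
  have \<gamma>: "\<gamma> = local_norm f x (?P *v n)" unfolding \<gamma>_def by (rule sketch_dual_norm_eq[OF hess_pd n])
  have \<gamma>0: "0 \<le> \<gamma>" by (simp add: \<gamma>)
  have L\<gamma>: "L * \<gamma> \<le> 1" using regime L0 by (simp add: \<gamma>_def field_simps)
  define \<alpha> where "\<alpha> = sgn_stepsize (L_alg * \<gamma>)"
  have "0 \<le> L_alg * \<gamma>" using L0 L_alg \<gamma>0 by simp
  from sgn_stepsize_equation(1)[OF this] have \<alpha>0: "0 < \<alpha>" by (simp add: \<alpha>_def)
  have step: "sgn_step f L_alg S x = x + (- \<alpha>) *\<^sub>R (?P *v n)"
    unfolding sgn_step_def sketch_newton_direction[OF hess_pd n] by (simp add: \<alpha>_def \<gamma>_def)
  have gP: "grad f x \<bullet> v = (hess f x *v (?P *v n)) \<bullet> v" if "?P *v v = v" for v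
    using sketch_proj_selfadjoint[OF hess_pd, where u = n and w = v] that by (simp add: n)
  have "?P *v (?P *v n) = ?P *v n"
    by (rule sketch_proj_span[OF hess_pd sketch_proj_in_span[OF hess_pd]])
  then have g\<gamma>: "grad f x \<bullet> (?P *v n) = \<gamma>\<^sup>2" by (simp add: gP \<gamma> local_norm_power2)
  define \<psi> where "\<psi> = \<alpha> - \<alpha>\<^sup>2 / 2 - L * \<gamma> * \<alpha> ^ 3 / 6"
  have "f (sgn_step f L_alg S x) \<le> f x + - \<alpha> * \<gamma>\<^sup>2 + (\<alpha> * \<gamma>)\<^sup>2 / 2 + L * (\<alpha> * \<gamma>) ^ 3 / 6"
    using semi_strong_upper_model[OF L L0, of x "(- \<alpha>) *\<^sub>R (?P *v n)"] \<alpha>0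
    by (simp add: step local_norm_scaleR g\<gamma> \<gamma>[symmetric] del: scaleR_minus_left)
  also have "\<dots> = f x - \<psi> * \<gamma>\<^sup>2"
    by (simp add: \<psi>_def power2_eq_square power3_eq_cube algebra_simps)
  finally have decrease: "\<psi> * \<gamma>\<^sup>2 \<le> f x - f (sgn_step f L_alg S x)" by simp
  define b where "b = max (sqrt (L_alg / L)) 2"
  have b0: "0 < b" by (simp add: b_def)
  have "\<alpha> = sgn_stepsize (L_alg / L * (L * \<gamma>))" using L0 by (simp add: \<alpha>_def)
  then have b: "17 / 24 \<le> b * \<psi>"
    unfolding b_def \<psi>_def using L0 L_alg \<gamma>0 L\<gamma> by (intro stepsize_progress_constant) auto
  have "0 < b * \<psi>" using b by linarith
  then have "0 \<le> \<psi>" using b0 by (simp add: zero_less_mult_iff)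
  then have "0 \<le> \<psi> * \<gamma>\<^sup>2" by simp
  with decrease show "f (sgn_step f L_alg S x) \<le> f x" by linarith
  have "grad f x \<bullet> u = (hess f x *v (?P *v n)) \<bullet> u" by (rule gP) (rule sketch_proj_span[OF hess_pd u])
  then have "- (\<gamma> * local_norm f x u) \<le> grad f x \<bullet> u"
    using local_Cauchy_Schwarz[of x "?P *v n" u] by (simp add: \<gamma>)
  then have "f x - f (x + u) \<le> 17 / 24 * \<gamma>\<^sup>2"
    by (rule semi_strong_lower_bound[OF L L0 \<gamma>0 L\<gamma>])
  also have "\<dots> \<le> b * \<psi> * \<gamma>\<^sup>2" using b by (intro mult_right_mono) auto
  also have "\<dots> \<le> b * (f x - f (sgn_step f L_alg S x))"
    using decrease b0 by (simp add: mult.assoc mult_left_mono)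
  finally show "f x - f (x + u) \<le> max (sqrt (L_alg / L)) 2 * (f x - f (sgn_step f L_alg S x))"
    unfolding b_def .
qed

section \<open>Separability along a projection that suits all Hessians\<close>

text \<open>
  If one projection \<open>P\<close> is self-adjoint for all Hessians, the Hessians have no mixed entries between the
  range and the kernel of \<open>P\<close>, so \<open>f\<close> is a sum of a function of \<open>P x\<close> and one of \<open>x - P x\<close>.
\<close>
lemma grad_invariant_along_kernel:
  fixes P :: "real^'d^'d"
  assumes sa: "\<And>y u w. (hess f y *v (P *v u)) \<bullet> w = (hess f y *v u) \<bullet> (P *v w)"
    and w: "P *v w = 0"
  shows "grad f (y + w) \<bullet> (P *v k) = grad f y \<bullet> (P *v k)"
proof -
  have "((\<lambda>t. grad f (y + t *\<^sub>R w) \<bullet> (P *v k)) has_real_derivative 0) (at t)" for t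
    using line_derivative_grad[where s = "\<lambda>t. t" and s' = 1, of t y w "P *v k"]
    by (simp add: sa[symmetric] w)
  from DERIV_isconst_all[OF allI, OF this, of 1 0] show ?thesis by simp
qed

text \<open>
  The integral formula makes the decrease obtained by moving only the component \<open>P k\<close> linear in \<open>P\<close>: along
  \<open>t \<mapsto> x + t P k\<close> the derivative in direction \<open>P k\<close> is the same as along \<open>t \<mapsto> x + t k\<close>, by separability.
\<close>
lemma separable_decrease:
  fixes P :: "real^'d^'d"
  assumes sa: "\<And>y u w. (hess f y *v (P *v u)) \<bullet> w = (hess f y *v u) \<bullet> (P *v w)"
    and idem: "\<And>v. P *v (P *v v) = P *v v"
  shows separable_decrease_integral:
      "f x - f (x + P *v k) = - integral {0..1} (\<lambda>t. grad f (x + t *\<^sub>R k)) \<bullet> (P *v k)"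
    and separable_decrease_nonneg: "(\<And>y. f (x + k) \<le> f y) \<Longrightarrow> f (x + P *v k) \<le> f x"
proof -
  have ker: "P *v (c *\<^sub>R (k - P *v k)) = 0" for c
    by (simp add: matrix_vector_mult_scaleR matrix_vector_mult_diff_distrib idem)
  have grad_eq: "grad f (x + t *\<^sub>R (P *v k)) \<bullet> (P *v k) = grad f (x + t *\<^sub>R k) \<bullet> (P *v k)" for t
  proof -
    have "x + t *\<^sub>R k = x + t *\<^sub>R (P *v k) + t *\<^sub>R (k - P *v k)" by (simp add: scaleR_diff_right)
    then show ?thesis using grad_invariant_along_kernel[OF sa ker, of "x + t *\<^sub>R (P *v k)" t k] by (simp only: add.assoc)
  qed
  have "((\<lambda>t. grad f (x + t *\<^sub>R k) \<bullet> (P *v k)) has_integral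
      f (x + 1 *\<^sub>R (P *v k)) - f (x + 0 *\<^sub>R (P *v k))) {0..1}"
    using line_derivative[where s = "\<lambda>t. t" and s' = 1, of _ x "P *v k"]
    by (intro fundamental_theorem_of_calculus)
      (auto simp: grad_eq has_real_derivative_iff_has_vector_derivative
        intro: has_vector_derivative_at_within)
  moreover have "(\<lambda>t. grad f (x + t *\<^sub>R k)) integrable_on {0..1}"
    by (intro integrable_continuous_interval continuous_on_compose2[OF continuous_grad])
      (auto intro!: continuous_intros)
  then have "((\<lambda>t. grad f (x + t *\<^sub>R k) \<bullet> (P *v k)) has_integral
      integral {0..1} (\<lambda>t. grad f (x + t *\<^sub>R k)) \<bullet> (P *v k)) {0..1}"
    using has_integral_linear[OF integrable_integral bounded_linear_inner_left] by (auto simp: o_def)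
  ultimately have "f (x + 1 *\<^sub>R (P *v k)) - f (x + 0 *\<^sub>R (P *v k))
      = integral {0..1} (\<lambda>t. grad f (x + t *\<^sub>R k)) \<bullet> (P *v k)"
    by (rule has_integral_unique)
  then show "f x - f (x + P *v k) = - integral {0..1} (\<lambda>t. grad f (x + t *\<^sub>R k)) \<bullet> (P *v k)"
    by simp
  assume min: "\<And>y. f (x + k) \<le> f y"
  define w where "w = k - P *v k"
  let ?D = "\<lambda>t. f (x + w + t *\<^sub>R (P *v k)) - f (x + t *\<^sub>R (P *v k))"
  have "(?D has_real_derivative 0) (at t)" for t
  proof -
    have "grad f (x + t *\<^sub>R (P *v k) + w) \<bullet> (P *v k) = grad f (x + t *\<^sub>R (P *v k)) \<bullet> (P *v k)"
      by (rule grad_invariant_along_kernel[OF sa]) (use ker[of 1] in \<open>simp add: w_def\<close>)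
    moreover have "x + w + t *\<^sub>R (P *v k) = x + t *\<^sub>R (P *v k) + w" by (simp add: add_ac)
    ultimately have "grad f (x + w + t *\<^sub>R (P *v k)) \<bullet> (P *v k)
        - grad f (x + t *\<^sub>R (P *v k)) \<bullet> (P *v k) = 0" by (simp only: diff_self)
    moreover have "(?D has_real_derivative grad f (x + w + t *\<^sub>R (P *v k)) \<bullet> (P *v k)
        - grad f (x + t *\<^sub>R (P *v k)) \<bullet> (P *v k)) (at t)"
      using DERIV_diff[OF line_derivative[where s = "\<lambda>t. t" and s' = 1, of t "x + w" "P *v k"]
          line_derivative[where s = "\<lambda>t. t" and s' = 1, of t x "P *v k"]]
      by simp
    ultimately show ?thesis by (simp only:)
  qed
  from DERIV_isconst_all[OF allI, OF this, of 1 0]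
  have "f (x + k) - f (x + P *v k) = f (x + w) - f x" by (simp add: w_def)
  with min[of "x + w"] show "f (x + P *v k) \<le> f x" by linarith
qed

end

section \<open>An isotropic mean forces the projections to be constant\<close>

text \<open>
  The resolution of the identity \<open>\<Sum>\<^sub>i r\<^sub>i r\<^sub>i\<^sup>T = K\<^sup>-\<^sup>1\<close>, from Gram--Schmidt applied to a basis.
\<close>
lemma orthonormal_frame:
  fixes K :: "real^'d^'d"
  assumes "positive_definite K"
  shows "\<exists>n r. \<forall>v. v = (\<Sum>i<(n::nat). (r i \<bullet> (K *v v)) *\<^sub>R r i)"
proof -
  obtain B :: "(real^'d) list" where B: "set B = Basis"
    using finite_list[OF finite_Basis] by blast
  obtain rs where rs: "\<forall>s\<in>set B. (\<Sum>r\<leftarrow>rs. (r \<bullet> (K *v s)) *\<^sub>R r) = s"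
    using gram_schmidt[OF assms] by blast
  have "(\<Sum>r\<leftarrow>rs. (r \<bullet> (K *v v)) *\<^sub>R r) = v" for v
    by (rule linear_eq_on[OF linear_frame_sum linear_ident, of v Basis]) (use rs B in auto)
  then have "v = (\<Sum>i<length rs. (rs ! i \<bullet> (K *v v)) *\<^sub>R (rs ! i))" for v
    by (simp add: sum_list_sum_nth lessThan_atLeast0)
  then show ?thesis by blast
qed

text \<open>
  This is the identity \<open>tr (P\<^sup>T A P K\<^sup>-\<^sup>1) = tr (A P K\<^sup>-\<^sup>1)\<close>, valid because \<open>P K\<^sup>-\<^sup>1\<close> is symmetric and \<open>P\<^sup>2 = P\<close>.
  It replaces an expression quadratic in \<open>P\<close> by a linear one.
\<close>
lemma frame_selfadjoint_projection_sum:
  fixes K A P :: "real^'d^'d" and n :: nat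
  assumes r: "\<And>v. v = (\<Sum>i<n. (r i \<bullet> (K *v v)) *\<^sub>R r i)"
    and K: "positive_definite K"
    and sa: "\<And>u w. (K *v (P *v u)) \<bullet> w = (K *v u) \<bullet> (P *v w)"
    and idem: "\<And>v. P *v (P *v v) = P *v v"
  shows "(\<Sum>j<n. (A *v (P *v r j)) \<bullet> (P *v r j)) = (\<Sum>i<n. (A *v (P *v r i)) \<bullet> r i)"
proof -
  define q where "q i j = r i \<bullet> (K *v (P *v r j))" for i j
  have Pr: "P *v r j = (\<Sum>i<n. q i j *\<^sub>R r i)" for j
    unfolding q_def by (rule r)
  have q: "q i j = q j i" for i j
  proof -
    have "q i j = (K *v (P *v r j)) \<bullet> r i" by (simp add: q_def inner_commute)
    also have "\<dots> = (K *v r j) \<bullet> (P *v r i)" by (rule sa)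
    also have "\<dots> = (K *v (P *v r i)) \<bullet> r j" by (rule positive_definite_sym[OF K])
    finally show ?thesis by (simp add: q_def inner_commute)
  qed
  have "(\<Sum>j<n. (A *v (P *v r j)) \<bullet> (P *v r j)) = (\<Sum>j<n. \<Sum>i<n. q i j * ((A *v (P *v r j)) \<bullet> r i))"
  proof (rule sum.cong[OF refl])
    fix j
    have "(A *v (P *v r j)) \<bullet> (P *v r j) = (A *v (P *v r j)) \<bullet> (\<Sum>i<n. q i j *\<^sub>R r i)"
      using Pr[of j] by simp
    also have "\<dots> = (\<Sum>i<n. q i j * ((A *v (P *v r j)) \<bullet> r i))" by (simp only: inner_sum_right inner_scaleR_right)
    finally show "(A *v (P *v r j)) \<bullet> (P *v r j) = (\<Sum>i<n. q i j * ((A *v (P *v r j)) \<bullet> r i))" .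
  qed
  also have "\<dots> = (\<Sum>i<n. \<Sum>j<n. q i j * ((A *v (P *v r j)) \<bullet> r i))" by (rule sum.swap)
  also have "\<dots> = (\<Sum>i<n. (A *v (P *v r i)) \<bullet> r i)"
  proof (rule sum.cong[OF refl])
    fix i
    have lin: "linear (\<lambda>v. (A *v (P *v v)) \<bullet> r i)"
      by (auto simp: linear_iff matrix_vector_right_distrib matrix_vector_mult_scaleR inner_add_left)
    have "(\<Sum>j<n. q i j * ((A *v (P *v r j)) \<bullet> r i)) = (A *v (P *v (\<Sum>j<n. q j i *\<^sub>R r j))) \<bullet> r i"
      unfolding linear_sum[OF lin] linear_scale[OF lin] by (simp add: q[of i])
    also have "\<dots> = (A *v (P *v (P *v r i))) \<bullet> r i" using Pr[of i] by simp
    finally show "(\<Sum>j<n. q i j * ((A *v (P *v r j)) \<bullet> r i)) = (A *v (P *v r i)) \<bullet> r i" by (simp add: idem)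
  qed
  finally show ?thesis .
qed

context positive_definite_hessian
begin

lemma sketch_proj_comp: "sketch_proj f S x *v (sketch_proj f S y *v v) = sketch_proj f S y *v v"
  by (rule sketch_proj_span[OF hess_pd sketch_proj_in_span[OF hess_pd]])

text \<open>
  All sketched projections of one sketch have the same range, so such a projection is determined by
  self-adjointness.
\<close>
lemma sketch_proj_eqI:
  assumes "\<And>u w. (hess f y *v (sketch_proj f S x *v u)) \<bullet> w = (hess f y *v u) \<bullet> (sketch_proj f S x *v w)"
  shows "sketch_proj f S y = sketch_proj f S x"
proof -
  have "sketch_proj f S y *v v = sketch_proj f S x *v v" for v
  proof -
    define w where "w = sketch_proj f S y *v v - sketch_proj f S x *v v"
    have wy: "sketch_proj f S y *v w = w" and wx: "sketch_proj f S x *v w = w"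
      by (simp_all add: w_def matrix_vector_mult_diff_distrib sketch_proj_comp)
    have "(hess f y *v w) \<bullet> w = (hess f y *v v) \<bullet> (sketch_proj f S y *v w)
        - (hess f y *v v) \<bullet> (sketch_proj f S x *v w)"
      unfolding assms[symmetric] sketch_proj_selfadjoint[OF hess_pd, symmetric]
      by (simp add: w_def matrix_vector_mult_diff_distrib inner_diff_left)
    then have "w = 0" by (intro positive_definite_eq_0[OF hess_pd]) (simp add: wx wy)
    then show ?thesis by (simp add: w_def)
  qed
  then show ?thesis by (simp add: matrix_eq)
qed

lemma local_norm_sketch_proj_diff:
  "(hess f x *v (sketch_proj f S x *v v - sketch_proj f S y *v v)) \<bullet> (sketch_proj f S x *v v - sketch_proj f S y *v v)
    = (hess f x *v (sketch_proj f S x *v v)) \<bullet> v - 2 * ((hess f x *v (sketch_proj f S y *v v)) \<bullet> v)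
      + (hess f x *v (sketch_proj f S y *v v)) \<bullet> (sketch_proj f S y *v v)"
proof -
  let ?X = "sketch_proj f S x" and ?Y = "sketch_proj f S y" and ?H = "hess f x"
  have sym: "(?H *v a) \<bullet> b = (?H *v b) \<bullet> a" for a b by (rule positive_definite_sym[OF hess_pd])
  have "(?H *v (?X *v v)) \<bullet> (?X *v v) = (?H *v (?X *v v)) \<bullet> v"
    using sketch_proj_selfadjoint[OF hess_pd, of x S "?X *v v" v] by (simp add: sketch_proj_comp)
  moreover have "(?H *v (?X *v v)) \<bullet> (?Y *v v) = (?H *v (?Y *v v)) \<bullet> v"
    using sketch_proj_selfadjoint[OF hess_pd, of x S v "?Y *v v"] sym by (simp add: sketch_proj_comp)
  moreover have "(?H *v (?Y *v v)) \<bullet> (?X *v v) = (?H *v (?X *v v)) \<bullet> (?Y *v v)" by (rule sym)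
  ultimately show ?thesis
    by (simp add: matrix_vector_mult_diff_distrib inner_diff_left inner_diff_right)
qed

lemma constant_sketch_proj_selfadjoint:
  assumes "\<forall>x. sketch_proj f T x = sketch_proj f T 0"
  shows "(hess f y *v (sketch_proj f T 0 *v u)) \<bullet> w = (hess f y *v u) \<bullet> (sketch_proj f T 0 *v w)"
  using sketch_proj_selfadjoint[OF hess_pd, of y T u w] unfolding assms[rule_format, of y] .

lemma constant_sketch_proj_decrease:
  assumes T: "\<forall>x. sketch_proj f T x = sketch_proj f T 0" and min: "\<And>y. f xstar \<le> f y"
  shows "f (x + sketch_proj f T 0 *v (xstar - x)) \<le> f x"
  by (rule separable_decrease_nonneg[OF constant_sketch_proj_selfadjoint[OF T] sketch_proj_comp])
    (simp add: min)

end

text \<open>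
  In the convergence statement \<open>c\<close> is \<open>\<tau>/d\<close>, the expected rank of the projection divided by the dimension.
\<close>
locale isotropic_sketches = positive_definite_hessian f + D: prob_space D
  for f :: "real^'d \<Rightarrow> real" and D :: "'d sketch measure" +
  fixes c :: real
  assumes sets_D: "sets D = sets sketch_space"
    and c_pos: "0 < c"
    and proj_mean: "\<And>x. (LINT T|D. sketch_proj f T x) = c *\<^sub>R Finite_Cartesian_Product.mat 1"
begin

text \<open>
  The Bochner integral of a function that is not integrable is 0, whereas the mean is a nonzero matrix.
  In particular the projection depends measurably on the sketch.
\<close>
lemma integrable_sketch_proj: "integrable D (\<lambda>T. sketch_proj f T x)"
proof (rule ccontr)
  assume "\<not> integrable D (\<lambda>T. sketch_proj f T x)"
  then have "c *\<^sub>R Finite_Cartesian_Product.mat 1 = (0 :: real^'d^'d)"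
    using proj_mean[of x] by (simp add: not_integrable_integral_eq)
  then have "(Finite_Cartesian_Product.mat 1 :: real^'d^'d) = 0" using c_pos by simp
  then have "(Finite_Cartesian_Product.mat 1 :: real^'d^'d) $ i $ i = 0" for i by (simp only: zero_index)
  then show False by (simp add: Finite_Cartesian_Product.mat_def)
qed

lemma has_bochner_integral_sketch_proj_form:
  fixes A :: "real^'d^'d"
  shows "has_bochner_integral D (\<lambda>T. (A *v (sketch_proj f T x *v v)) \<bullet> w) (c * ((A *v v) \<bullet> w))"
proof -
  have "linear (\<lambda>Q. (A *v (Q *v v)) \<bullet> w)"
    by (auto simp: linear_iff matrix_vector_mult_add_rdistrib matrix_vector_right_distrib
        scaleR_matrix_vector_assoc[symmetric] matrix_vector_mult_scaleR inner_add_left)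
  then have bl: "bounded_linear (\<lambda>Q. (A *v (Q *v v)) \<bullet> w)" by (simp add: linear_conv_bounded_linear)
  have "has_bochner_integral D (\<lambda>T. sketch_proj f T x) (c *\<^sub>R Finite_Cartesian_Product.mat 1)"
    using integrable_sketch_proj[of x] proj_mean[of x] by (simp add: has_bochner_integral_iff)
  from has_bochner_integral_bounded_linear[OF bl this] show ?thesis
    by (simp add: scaleR_matrix_vector_assoc[symmetric] matrix_vector_mult_scaleR)
qed

text \<open>
  This is where the isotropy of the mean at every point takes effect. Let \<open>P\<close>, \<open>Q\<close> be the projections at \<open>x\<close>,
  \<open>y\<close>. For a frame \<open>r\<^sub>i\<close> that is orthonormal at \<open>y\<close>, the sum of \<open>\<parallel>(P - Q) r\<^sub>i\<parallel>\<^sub>x\<^sup>2\<close> expands to an expression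
  that is linear in \<open>P\<close> and \<open>Q\<close>, the square of \<open>Q\<close> being removed by the trace identity. The mean of \<open>P\<close>
  equals the mean of \<open>Q\<close>, so this nonnegative sum has mean 0 and vanishes almost surely.
\<close>
lemma AE_sketch_proj_eq: "AE T in D. sketch_proj f T x = sketch_proj f T y"
proof -
  obtain n :: nat and r where r: "\<And>v. v = (\<Sum>i<n. (r i \<bullet> (hess f y *v v)) *\<^sub>R r i)"
    using orthonormal_frame[OF hess_pd[of y]] by (elim exE) metis
  define d where "d T i = sketch_proj f T x *v r i - sketch_proj f T y *v r i" for T i
  define W where "W T = (\<Sum>i<n. (hess f x *v d T i) \<bullet> d T i)" for T
  \<comment> \<open>The mixed terms contribute the sum for \<open>y\<close> twice with a minus sign, and the square at \<open>y\<close> returns it once.\<close>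
  have W: "W T = (\<Sum>i<n. (hess f x *v (sketch_proj f T x *v r i)) \<bullet> r i)
      - (\<Sum>i<n. (hess f x *v (sketch_proj f T y *v r i)) \<bullet> r i)" for T
  proof -
    have "(\<Sum>j<n. (hess f x *v (sketch_proj f T y *v r j)) \<bullet> (sketch_proj f T y *v r j))
        = (\<Sum>i<n. (hess f x *v (sketch_proj f T y *v r i)) \<bullet> r i)"
      by (rule frame_selfadjoint_projection_sum[OF r hess_pd sketch_proj_selfadjoint[OF hess_pd] sketch_proj_comp])
    then show ?thesis
      unfolding W_def d_def local_norm_sketch_proj_diff
      by (simp add: sum.distrib sum_subtractf flip: sum_distrib_left)
  qed
  have "has_bochner_integral D W ((\<Sum>i<n. c * ((hess f x *v r i) \<bullet> r i)) - (\<Sum>i<n. c * ((hess f x *v r i) \<bullet> r i)))"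
    unfolding W by (intro has_bochner_integral_diff has_bochner_integral_sum has_bochner_integral_sketch_proj_form)
  then have W0: "has_bochner_integral D W 0" by simp
  have "0 \<le> W T" for T unfolding W_def by (intro sum_nonneg positive_definite_nonneg[OF hess_pd])
  then have "AE T in D. W T = 0"
    using W0 integral_nonneg_eq_0_iff_AE[of D W] by (simp add: has_bochner_integral_iff)
  then show ?thesis
  proof (rule AE_mp, intro AE_I2 impI)
    fix T assume "W T = 0"
    then have "\<forall>i<n. (hess f x *v d T i) \<bullet> d T i = 0"
      unfolding W_def by (subst (asm) sum_nonneg_eq_0_iff) (auto simp: positive_definite_nonneg[OF hess_pd])
    then have d0: "d T i = 0" if "i < n" for i using that positive_definite_eq_0[OF hess_pd] by blast
    have lin: "linear (\<lambda>v. sketch_proj f T x *v v - sketch_proj f T y *v v)"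
      by (intro linear_compose_sub matrix_vector_mul_linear)
    have "sketch_proj f T x *v v - sketch_proj f T y *v v = 0" for v
    proof -
      have "sketch_proj f T x *v v - sketch_proj f T y *v v
          = (\<Sum>i<n. (r i \<bullet> (hess f y *v v)) *\<^sub>R d T i)"
        by (subst (1 2) r[of v]) (simp add: linear_sum[OF lin] linear_scale[OF lin] d_def
            linear_sum[OF matrix_vector_mul_linear] sum_subtractf matrix_vector_mult_scaleR
            scaleR_diff_right)
      then show ?thesis by (simp add: d0)
    qed
    then show "sketch_proj f T x = sketch_proj f T y" by (simp add: matrix_eq)
  qed
qed

text \<open>
  The exceptional null set of the previous lemma depends on the two points. It is made uniform by taking
  the points from a countable dense set: self-adjointness at \<open>x\<close> is a closed condition on \<open>x\<close>, because
  the Hessian is continuous.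
\<close>
lemma AE_sketch_proj_constant: "AE T in D. \<forall>x. sketch_proj f T x = sketch_proj f T 0"
proof -
  obtain Q :: "(real^'d) set" where Q: "countable Q"
    and dense: "\<And>X. open X \<Longrightarrow> X \<noteq> {} \<Longrightarrow> \<exists>d\<in>Q. d \<in> X"
    by (rule countable_dense_setE) blast
  have "AE T in D. \<forall>y\<in>Q. sketch_proj f T y = sketch_proj f T 0"
    using Q by (simp add: AE_ball_countable AE_sketch_proj_eq)
  then show ?thesis
  proof (rule AE_mp, intro AE_I2 impI allI)
    fix T x assume T: "\<forall>y\<in>Q. sketch_proj f T y = sketch_proj f T 0"
    let ?P = "sketch_proj f T 0"
    have "(hess f x *v (?P *v u)) \<bullet> w = (hess f x *v u) \<bullet> (?P *v w)" for u w
    proof -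
      \<comment> \<open>The open set of points where self-adjointness fails misses the dense set.\<close>
      define N where "N = {y. (hess f y *v (?P *v u)) \<bullet> w \<noteq> (hess f y *v u) \<bullet> (?P *v w)}"
      have lin: "linear (\<lambda>A::real^'d^'d. (A *v a) \<bullet> b)" for a b
        by (auto simp: linear_iff matrix_vector_mult_add_rdistrib scaleR_matrix_vector_assoc[symmetric]
            inner_add_left)
      have cont: "continuous_on UNIV (\<lambda>y. (hess f y *v a) \<bullet> b)" for a b
        by (rule continuous_on_compose2[OF linear_continuous_on continuous_hess, where t = UNIV])
          (use lin in \<open>auto simp: linear_conv_bounded_linear\<close>)
      have "open N" unfolding N_def by (rule open_Collect_neq[OF cont cont])
      moreover have "y \<notin> N" if "y \<in> Q" for y
        using sketch_proj_selfadjoint[OF hess_pd, of y T u w] T that by (simp add: N_def)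
      ultimately have "N = {}" using dense by blast
      then show ?thesis by (auto simp: N_def)
    qed
    then show "sketch_proj f T x = ?P" by (rule sketch_proj_eqI)
  qed
qed

text \<open>
  A projection does not increase the local norm, so its mean \<open>c I\<close> does not either.
\<close>
lemma c_le_1: "c \<le> 1"
proof -
  define v :: "real^'d" where "v = axis undefined 1"
  have v: "v \<noteq> 0" by (simp add: v_def axis_eq_0_iff)
  define N where "N = (hess f 0 *v v) \<bullet> v"
  have N: "0 < N" using v hess_pd[of 0] by (simp add: N_def positive_definite_def)
  have "(hess f 0 *v (sketch_proj f T 0 *v v)) \<bullet> v \<le> N" for T
  proof -
    let ?P = "sketch_proj f T 0"
    have eq: "(hess f 0 *v (?P *v v)) \<bullet> v = (hess f 0 *v (?P *v v)) \<bullet> (?P *v v)"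
      using sketch_proj_selfadjoint[OF hess_pd, of 0 T "?P *v v" v] by (simp add: sketch_proj_comp)
    have "0 \<le> (hess f 0 *v (v - ?P *v v)) \<bullet> (v - ?P *v v)"
      by (rule positive_definite_nonneg[OF hess_pd])
    also have "\<dots> = N - (hess f 0 *v (?P *v v)) \<bullet> v"
      using eq positive_definite_sym[OF hess_pd, of 0 v "?P *v v"]
      by (simp add: N_def matrix_vector_mult_diff_distrib inner_diff_left inner_diff_right)
    finally show ?thesis by simp
  qed
  then have "(LINT T|D. (hess f 0 *v (sketch_proj f T 0 *v v)) \<bullet> v) \<le> (LINT T|D. N)"
    using has_bochner_integral_sketch_proj_form[of "hess f 0" 0 v v]
    by (intro integral_mono) (auto simp: has_bochner_integral_iff)
  then have "c * N \<le> N"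
    using has_bochner_integral_sketch_proj_form[of "hess f 0" 0 v v]
    by (simp add: has_bochner_integral_iff N_def D.prob_space)
  with N show ?thesis by simp
qed

text \<open>
  Since the decrease obtained by correcting the component of \<open>x - xstar\<close> in the range of the sketch is linear
  in the projection, its mean is \<open>c\<close> times the value for the identity, which is the full gap.
\<close>
lemma mean_separable_decrease:
  assumes min: "\<And>y. f xstar \<le> f y"
  shows "AE T in D. 0 \<le> f x - f (x + sketch_proj f T 0 *v (xstar - x))"
    and "has_bochner_integral D (\<lambda>T. f x - f (x + sketch_proj f T 0 *v (xstar - x))) (c * (f x - f xstar))"
proof -
  let ?k = "xstar - x"
  define m where "m = integral {0..1} (\<lambda>t. grad f (x + t *\<^sub>R ?k))"
  show "AE T in D. 0 \<le> f x - f (x + sketch_proj f T 0 *v ?k)"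
    using AE_sketch_proj_constant
  proof (rule AE_mp, intro AE_I2 impI)
    fix T assume T: "\<forall>x. sketch_proj f T x = sketch_proj f T 0"
    from constant_sketch_proj_decrease[OF this min, of x]
    show "0 \<le> f x - f (x + sketch_proj f T 0 *v ?k)" by simp
  qed
  have eq: "AE T in D. - ((Finite_Cartesian_Product.mat 1 *v (sketch_proj f T 0 *v ?k)) \<bullet> m)
      = f x - f (x + sketch_proj f T 0 *v ?k)"
    using AE_sketch_proj_constant
  proof (rule AE_mp, intro AE_I2 impI)
    fix T assume T: "\<forall>x. sketch_proj f T x = sketch_proj f T 0"
    show "- ((Finite_Cartesian_Product.mat 1 *v (sketch_proj f T 0 *v ?k)) \<bullet> m)
      = f x - f (x + sketch_proj f T 0 *v ?k)"
      using separable_decrease_integral[OF constant_sketch_proj_selfadjoint[OF T] sketch_proj_comp, of x ?k]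
      by (simp add: m_def inner_commute)
  qed
  have "f x - f (x + Finite_Cartesian_Product.mat 1 *v ?k) = - m \<bullet> (Finite_Cartesian_Product.mat 1 *v ?k)"
    unfolding m_def using separable_decrease_integral[of "Finite_Cartesian_Product.mat 1" x ?k] by simp
  then have total: "- (?k \<bullet> m) = f x - f xstar" by (simp add: inner_commute)
  have "(\<lambda>T. f x - f (x + sketch_proj f T 0 *v ?k)) \<in> borel_measurable D"
  proof -
    have "linear (\<lambda>Q::real^'d^'d. Q *v ?k)"
      by (auto simp: linear_iff matrix_vector_mult_add_rdistrib scaleR_matrix_vector_assoc[symmetric])
    then have "continuous_on UNIV (\<lambda>Q. f x - f (x + Q *v ?k))"
      by (intro continuous_intros continuous_on_compose2[OF continuous_f, where t = UNIV] linear_continuous_on)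
        (auto simp: linear_conv_bounded_linear)
    from borel_measurable_continuous_on[OF this borel_measurable_integrable[OF integrable_sketch_proj]]
    show ?thesis .
  qed
  moreover have "has_bochner_integral D (\<lambda>T. - ((Finite_Cartesian_Product.mat 1 *v (sketch_proj f T 0 *v ?k)) \<bullet> m))
      (- (c * ((Finite_Cartesian_Product.mat 1 *v ?k) \<bullet> m)))"
    by (intro has_bochner_integral_minus has_bochner_integral_sketch_proj_form)
  then have "has_bochner_integral D (\<lambda>T. - ((Finite_Cartesian_Product.mat 1 *v (sketch_proj f T 0 *v ?k)) \<bullet> m))
      (c * (f x - f xstar))" by (simp flip: total)
  ultimately show "has_bochner_integral D (\<lambda>T. f x - f (x + sketch_proj f T 0 *v ?k)) (c * (f x - f xstar))"
    using has_bochner_integral_cong_AE[OF _ _ eq] by (metis (no_types, lifting) has_bochner_integral_iff borel_measurable_integrable)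
qed

end

section \<open>Measurability of the iterates\<close>

lemma borel_measurable_vec_nth:
  fixes v :: "'w \<Rightarrow> 'a::real_normed_vector ^ 'n"
  assumes "v \<in> borel_measurable M"
  shows "(\<lambda>\<omega>. v \<omega> $ i) \<in> borel_measurable M"
  by (rule borel_measurable_continuous_on[OF _ assms]) (intro continuous_intros)

lemma borel_measurable_vecI:
  fixes v :: "'w \<Rightarrow> real ^ 'n"
  assumes "\<And>i. (\<lambda>\<omega>. v \<omega> $ i) \<in> borel_measurable M"
  shows "v \<in> borel_measurable M"
  unfolding borel_measurable_euclidean_space[of v]
  using assms by (auto simp: Basis_vec_def inner_axis)

lemma borel_measurable_det:
  fixes A :: "'w \<Rightarrow> real ^ 'n ^ 'n"
  assumes "\<And>i j. (\<lambda>\<omega>. A \<omega> $ i $ j) \<in> borel_measurable M"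
  shows "(\<lambda>\<omega>. det (A \<omega>)) \<in> borel_measurable M"
  unfolding det_def using assms
  by (intro borel_measurable_sum borel_measurable_times borel_measurable_const borel_measurable_prod)

text \<open>
  For positive definite \<open>H\<close> and a projection \<open>P\<close> with the range of a sketch, the matrix
  \<open>N = P\<^sup>T H P + (I - P)\<^sup>T (I - P)\<close> is positive definite and the sketched Newton direction solves \<open>N n = P\<^sup>T g\<close>. Cramer's rule then writes it as a quotient of polynomials in
  the entries of \<open>P\<close>, \<open>H\<close> and \<open>g\<close>. Taking \<open>P\<close> at a fixed base point separates the dependence on the sketch
  from that on the current iterate and so gives joint measurability.
\<close>
definition normal_matrix :: "real^'d^'d \<Rightarrow> real^'d^'d \<Rightarrow> real^'d^'d" where
  "normal_matrix P H = Finite_Cartesian_Product.transpose P ** H ** P +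
     Finite_Cartesian_Product.transpose (Finite_Cartesian_Product.mat 1 - P) ** (Finite_Cartesian_Product.mat 1 - P)"

definition cramer_direction :: "real^'d^'d \<Rightarrow> real^'d^'d \<Rightarrow> real^'d \<Rightarrow> real^'d" where
  "cramer_direction P H g = (\<chi> k.
     det (\<chi> i j. if j = k then (Finite_Cartesian_Product.transpose P *v g) $ i else normal_matrix P H $ i $ j)
       / det (normal_matrix P H))"

lemma borel_measurable_cramer_direction:
  assumes "P \<in> borel_measurable M" "H \<in> borel_measurable M" "g \<in> borel_measurable M"
  shows "(\<lambda>\<omega>. cramer_direction (P \<omega>) (H \<omega>) (g \<omega>)) \<in> borel_measurable M"
proof (rule borel_measurable_vecI)
  fix k
  have [measurable]: "(\<lambda>\<omega>. P \<omega> $ i $ j) \<in> borel_measurable M" "(\<lambda>\<omega>. H \<omega> $ i $ j) \<in> borel_measurable M"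
    "(\<lambda>\<omega>. g \<omega> $ i) \<in> borel_measurable M" for i j
    using assms by (auto intro!: borel_measurable_vec_nth)
  have N[measurable]: "(\<lambda>\<omega>. normal_matrix (P \<omega>) (H \<omega>) $ i $ j) \<in> borel_measurable M" for i j
    by (simp add: normal_matrix_def matrix_matrix_mult_def Finite_Cartesian_Product.transpose_def
        Finite_Cartesian_Product.mat_def)
  have "(\<lambda>\<omega>. det (\<chi> i j. if j = k then (Finite_Cartesian_Product.transpose (P \<omega>) *v g \<omega>) $ i
      else normal_matrix (P \<omega>) (H \<omega>) $ i $ j)) \<in> borel_measurable M"
  proof (rule borel_measurable_det)
    fix i j
    have "(\<lambda>\<omega>. (Finite_Cartesian_Product.transpose (P \<omega>) *v g \<omega>) $ i) \<in> borel_measurable M"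
      by (simp add: matrix_vector_mult_def Finite_Cartesian_Product.transpose_def del: transpose_matrix_vector)
    then show "(\<lambda>\<omega>. (\<chi> i j. if j = k then (Finite_Cartesian_Product.transpose (P \<omega>) *v g \<omega>) $ i
      else normal_matrix (P \<omega>) (H \<omega>) $ i $ j) $ i $ j) \<in> borel_measurable M"
      using N[of i j] by (cases "j = k") (simp_all del: transpose_matrix_vector)
  qed
  then show "(\<lambda>\<omega>. cramer_direction (P \<omega>) (H \<omega>) (g \<omega>) $ k) \<in> borel_measurable M"
    unfolding cramer_direction_def vec_lambda_beta
    by (intro borel_measurable_divide borel_measurable_det[OF N])
qed

context positive_definite_hessian
begin

lemma sketch_newton_direction_cramer:
  assumes n: "hess f x *v n = grad f x"
  shows "sketch_proj f S x *v n = cramer_direction (sketch_proj f S y) (hess f x) (grad f x)"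
proof -
  let ?P = "sketch_proj f S y" and ?H = "hess f x" and ?n = "sketch_proj f S x *v n"
  let ?N = "normal_matrix ?P ?H" and ?t = "Finite_Cartesian_Product.transpose :: real^'d^'d \<Rightarrow> _"
  have N: "?N *v u = ?t ?P *v (?H *v (?P *v u)) + ?t (Finite_Cartesian_Product.mat 1 - ?P) *v (u - ?P *v u)" for u
    by (simp add: normal_matrix_def matrix_vector_mult_add_rdistrib matrix_vector_mult_diff_rdistrib
        flip: matrix_vector_mul_assoc)
  have "?N *v ?n = ?t ?P *v grad f x"
  proof (rule vector_eq_rdot[THEN iffD1, rule_format])
    fix w
    have "(?N *v ?n) \<bullet> w = (?H *v ?n) \<bullet> (?P *v w)"
      by (simp add: N dot_lmul_matrix sketch_proj_comp inner_add_left)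
    also have "\<dots> = (?H *v n) \<bullet> (?P *v w)"
      unfolding sketch_proj_selfadjoint[OF hess_pd] by (simp add: sketch_proj_comp)
    finally show "(?N *v ?n) \<bullet> w = (?t ?P *v grad f x) \<bullet> w" by (simp add: n dot_lmul_matrix)
  qed
  moreover have "det ?N \<noteq> 0"
  proof -
    have "u = 0" if "?N *v u = 0" for u
    proof -
      have "(?N *v u) \<bullet> u = (?H *v (?P *v u)) \<bullet> (?P *v u) + (u - ?P *v u) \<bullet> (u - ?P *v u)"
        by (simp add: N dot_lmul_matrix inner_add_left matrix_vector_mult_diff_rdistrib)
      then have "(?H *v (?P *v u)) \<bullet> (?P *v u) + (u - ?P *v u) \<bullet> (u - ?P *v u) = 0"
        using that by simp
      moreover have "0 \<le> (?H *v (?P *v u)) \<bullet> (?P *v u)" by (rule positive_definite_nonneg[OF hess_pd])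
      moreover have "0 \<le> (u - ?P *v u) \<bullet> (u - ?P *v u)" by simp
      ultimately have "(?H *v (?P *v u)) \<bullet> (?P *v u) = 0" "(u - ?P *v u) \<bullet> (u - ?P *v u) = 0"
        by linarith+
      then have "?P *v u = 0" "u - ?P *v u = 0"
        using positive_definite_eq_0[OF hess_pd] by auto
      then show "u = 0" by simp
    qed
    then have "\<exists>B. B ** ?N = Finite_Cartesian_Product.mat 1"
      unfolding matrix_left_invertible_ker by blast
    then show ?thesis by (simp add: invertible_left_inverse flip: invertible_det_nz)
  qed
  ultimately show ?thesis unfolding cramer_direction_def by (subst (asm) cramer) auto
qed

lemma borel_measurable_sgn_step:
  assumes P: "(\<lambda>T. sketch_proj f T 0) \<in> borel_measurable sketch_space"
    and T: "T \<in> N \<rightarrow>\<^sub>M sketch_space" and X: "X \<in> borel_measurable N"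
  shows "(\<lambda>\<omega>. sgn_step f L (T \<omega>) (X \<omega>)) \<in> borel_measurable N"
proof -
  define d where "d \<omega> = cramer_direction (sketch_proj f (T \<omega>) 0) (hess f (X \<omega>)) (grad f (X \<omega>))" for \<omega>
  have HX: "(\<lambda>\<omega>. hess f (X \<omega>)) \<in> borel_measurable N"
    by (rule borel_measurable_continuous_on[OF continuous_hess X])
  have d: "d \<in> borel_measurable N" unfolding d_def
    by (intro borel_measurable_cramer_direction HX measurable_compose[OF T P]
        borel_measurable_continuous_on[OF continuous_grad X])
  have [measurable]: "(\<lambda>\<omega>. hess f (X \<omega>) $ i $ j) \<in> borel_measurable N" "(\<lambda>\<omega>. d \<omega> $ i) \<in> borel_measurable N" for i j
    using HX d by (auto intro!: borel_measurable_vec_nth)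
  have ln: "(\<lambda>\<omega>. local_norm f (X \<omega>) (d \<omega>)) \<in> borel_measurable N"
    unfolding local_norm_def inner_vec_def matrix_vector_mult_def by simp
  have step: "sgn_step f L (T \<omega>) (X \<omega>) = X \<omega> - sgn_stepsize (L * local_norm f (X \<omega>) (d \<omega>)) *\<^sub>R d \<omega>" for \<omega>
  proof -
    define n where "n = matrix_inv (hess f (X \<omega>)) *v grad f (X \<omega>)"
    have n: "hess f (X \<omega>) *v n = grad f (X \<omega>)" unfolding n_def by (rule hess_matrix_inv)
    show ?thesis
      unfolding sgn_step_def sketch_newton_direction[OF hess_pd n] sketch_dual_norm_eq[OF hess_pd n]
        sketch_newton_direction_cramer[OF n, of _ 0] d_def ..
  qed
  have "sgn_stepsize \<in> borel_measurable borel" unfolding sgn_stepsize_def[abs_def] by measurable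
  then show ?thesis unfolding step
    using X d ln by (intro borel_measurable_diff borel_measurable_scaleR
        measurable_compose[OF borel_measurable_times[OF borel_measurable_const ln]])
qed

lemma borel_measurable_sgn_iterate:
  assumes P: "(\<lambda>T. sketch_proj f T 0) \<in> borel_measurable sketch_space"
    and S: "\<And>j. j < k \<Longrightarrow> S j \<in> N \<rightarrow>\<^sub>M sketch_space"
  shows "(\<lambda>\<omega>. sgn_iterate f L x0 (\<lambda>j. S j \<omega>) k) \<in> borel_measurable N"
  using S
proof (induction k)
  case 0
  then show ?case by simp
next
  case (Suc k)
  then show ?case by (simp add: borel_measurable_sgn_step[OF P])
qed

end

lemma sgn_iterate_cong:
  "(\<And>j. j < k \<Longrightarrow> S j = S' j) \<Longrightarrow> sgn_iterate f L x0 S k = sgn_iterate f L x0 S' k"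
  by (induction k) auto

section \<open>Convergence in expectation\<close>

text \<open>
  The derived variables may have different types, so their independence is expressed as an identity of
  joint laws.
\<close>
lemma (in prob_space) joint_distr_of_indep_var:
  assumes ind: "indep_var N1 Y1 N2 Y2"
    and g1: "g1 \<in> N1 \<rightarrow>\<^sub>M K1" and g2: "g2 \<in> N2 \<rightarrow>\<^sub>M K2"
  shows "distr M K1 (\<lambda>\<omega>. g1 (Y1 \<omega>)) \<Otimes>\<^sub>M distr M K2 (\<lambda>\<omega>. g2 (Y2 \<omega>))
    = distr M (K1 \<Otimes>\<^sub>M K2) (\<lambda>\<omega>. (g1 (Y1 \<omega>), g2 (Y2 \<omega>)))"
proof -
  have Y1: "Y1 \<in> M \<rightarrow>\<^sub>M N1" and Y2: "Y2 \<in> M \<rightarrow>\<^sub>M N2"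
    and joint: "distr M N1 Y1 \<Otimes>\<^sub>M distr M N2 Y2 = distr M (N1 \<Otimes>\<^sub>M N2) (\<lambda>\<omega>. (Y1 \<omega>, Y2 \<omega>))"
    using ind unfolding indep_var_distribution_eq by auto
  have h1: "g1 \<in> distr M N1 Y1 \<rightarrow>\<^sub>M K1" and h2: "g2 \<in> distr M N2 Y2 \<rightarrow>\<^sub>M K2"
    using g1 g2 by simp_all
  interpret N2: prob_space "distr M N2 Y2" by (rule prob_space_distr[OF Y2])
  interpret K2: prob_space "distr (distr M N2 Y2) K2 g2" by (rule N2.prob_space_distr[OF h2])
  have "distr M K1 (\<lambda>\<omega>. g1 (Y1 \<omega>)) \<Otimes>\<^sub>M distr M K2 (\<lambda>\<omega>. g2 (Y2 \<omega>))
      = distr (distr M N1 Y1) K1 g1 \<Otimes>\<^sub>M distr (distr M N2 Y2) K2 g2"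
    using distr_distr[OF g1 Y1] distr_distr[OF g2 Y2] by (simp add: o_def)
  also have "\<dots> = distr (distr M (N1 \<Otimes>\<^sub>M N2) (\<lambda>\<omega>. (Y1 \<omega>, Y2 \<omega>))) (K1 \<Otimes>\<^sub>M K2) (\<lambda>(x, y). (g1 x, g2 y))"
    unfolding joint[symmetric] by (rule pair_measure_distr[OF h1 h2]) unfold_locales
  also have "\<dots> = distr M (K1 \<Otimes>\<^sub>M K2) (\<lambda>\<omega>. (g1 (Y1 \<omega>), g2 (Y2 \<omega>)))"
    using g1 g2 Y1 Y2 by (subst distr_distr) (auto simp: o_def)
  finally show ?thesis .
qed

context isotropic_sketches
begin

text \<open>
  The current iterate is a function of the earlier sketches and hence independent of the new one. By
  Tonelli's theorem the expected decrease that the new sketch makes possible is \<open>c\<close> times the expected gap, and the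
  step achieves the fraction \<open>1/b\<close> of it. Tonelli applies because the
  possible decrease is nonnegative, and it yields the integrability of that decrease.
\<close>
lemma sgn_expected_decrease:
  fixes M :: "'w measure" and x0 :: "real^'d"
  assumes "prob_space M"
    and indep: "prob_space.indep_vars M (\<lambda>_. sketch_space) S UNIV"
    and distr: "distr M sketch_space (S k) = D"
    and L: "semi_strongly_self_concordant L f" and L0: "0 < L" and L_alg: "L \<le> L_alg"
    and min: "\<And>y. f xstar \<le> f y"
  defines "X \<equiv> (\<lambda>k \<omega>. sgn_iterate f L_alg x0 (\<lambda>j. S j \<omega>) k)"
  defines "b \<equiv> max (sqrt (L_alg / L)) 2"
  assumes regime: "AE \<omega> in M. sketch_dual_norm f (X k \<omega>) (S k \<omega>) (sketch_grad f (S k \<omega>) (X k \<omega>)) \<le> 1 / L"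
    and int: "integrable M (\<lambda>\<omega>. f (X k \<omega>) - f xstar)"
  shows "integrable M (\<lambda>\<omega>. f (X (Suc k) \<omega>) - f xstar)"
    and "(LINT \<omega>|M. f (X (Suc k) \<omega>) - f xstar) \<le> (1 - c / b) * (LINT \<omega>|M. f (X k \<omega>) - f xstar)"
proof -
  interpret M: prob_space M by fact
  have P: "(\<lambda>T. sketch_proj f T 0) \<in> borel_measurable sketch_space"
    using borel_measurable_integrable[OF integrable_sketch_proj] measurable_cong_sets[OF sets_D refl] by blast
  have S[measurable]: "S j \<in> M \<rightarrow>\<^sub>M sketch_space" for j
    using indep by (auto simp: M.indep_vars_def)
  have X: "X j \<in> borel_measurable M" for j
    unfolding X_def by (intro borel_measurable_sgn_iterate[OF P] S)
  define dec where "dec x T = f x - f (x + sketch_proj f T 0 *v (xstar - x))" for x T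
  have dec_meas: "(\<lambda>z. dec (fst z) (snd z)) \<in> borel_measurable (borel \<Otimes>\<^sub>M sketch_space)"
  proof -
    have [measurable]: "(\<lambda>z. sketch_proj f (snd z) 0) \<in> borel_measurable (borel \<Otimes>\<^sub>M sketch_space)"
      by (rule measurable_compose[OF measurable_snd P])
    have [measurable]: "(\<lambda>z. sketch_proj f (snd z) 0 $ i $ j) \<in> borel_measurable (borel \<Otimes>\<^sub>M sketch_space)"
      for i j by (intro borel_measurable_vec_nth) measurable
    have [measurable]: "(\<lambda>z. (fst z :: real^'d) $ i) \<in> borel_measurable (borel \<Otimes>\<^sub>M sketch_space)" for i
      by (rule borel_measurable_vec_nth[OF measurable_fst])
    have 1: "(\<lambda>z. fst z + sketch_proj f (snd z) 0 *v (xstar - fst z)) \<in> borel_measurable (borel \<Otimes>\<^sub>M sketch_space)"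
      by (rule borel_measurable_vecI) (simp add: matrix_vector_mult_def)
    show ?thesis unfolding dec_def
      by (intro borel_measurable_diff borel_measurable_continuous_on[OF continuous_f 1]
          borel_measurable_continuous_on[OF continuous_f measurable_fst])
  qed
  have "M.indep_var (PiM {..<k} (\<lambda>_. sketch_space)) (\<lambda>\<omega>. restrict (\<lambda>i. S i \<omega>) {..<k})
      (PiM {k} (\<lambda>_. sketch_space)) (\<lambda>\<omega>. restrict (\<lambda>i. S i \<omega>) {k})"
    by (rule M.indep_var_restrict[OF indep]) auto
  note joint = M.joint_distr_of_indep_var[OF this]
  have X_eq: "sgn_iterate f L_alg x0 (restrict (\<lambda>i. S i \<omega>) {..<k}) k = X k \<omega>" for \<omega>
    unfolding X_def by (rule sgn_iterate_cong) simp
  define \<mu> where "\<mu> = distr M borel (X k)"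
  have joint: "\<mu> \<Otimes>\<^sub>M D = distr M (borel \<Otimes>\<^sub>M sketch_space) (\<lambda>\<omega>. (X k \<omega>, S k \<omega>))"
    using joint[of "\<lambda>s. sgn_iterate f L_alg x0 s k" borel "\<lambda>s. s k" sketch_space]
    by (simp add: X_eq \<mu>_def distr borel_measurable_sgn_iterate[OF P] measurable_component_singleton)
  interpret \<mu>: prob_space \<mu> unfolding \<mu>_def by (rule M.prob_space_distr[OF X])
  have gap_nonneg: "0 \<le> f x - f xstar" for x using min[of x] by simp
  have "(\<integral>\<^sup>+\<omega>. ennreal (dec (X k \<omega>) (S k \<omega>)) \<partial>M)
      = (\<integral>\<^sup>+z. ennreal (dec (fst z) (snd z)) \<partial>distr M (borel \<Otimes>\<^sub>M sketch_space) (\<lambda>\<omega>. (X k \<omega>, S k \<omega>)))"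
    using dec_meas X S by (subst nn_integral_distr) auto
  also have "\<dots> = (\<integral>\<^sup>+z. ennreal (dec (fst z) (snd z)) \<partial>(\<mu> \<Otimes>\<^sub>M D))" by (simp only: joint)
  also have "\<dots> = (\<integral>\<^sup>+x. \<integral>\<^sup>+T. ennreal (dec x T) \<partial>D \<partial>\<mu>)"
  proof -
    have "sets (\<mu> \<Otimes>\<^sub>M D) = sets (borel \<Otimes>\<^sub>M sketch_space)"
      using sets_D by (intro sets_pair_measure_cong) (auto simp: \<mu>_def)
    from measurable_cong_sets[OF this refl] dec_meas
    have "(\<lambda>z. dec (fst z) (snd z)) \<in> borel_measurable (\<mu> \<Otimes>\<^sub>M D)" by blast
    then have "(\<lambda>z. ennreal (dec (fst z) (snd z))) \<in> borel_measurable (\<mu> \<Otimes>\<^sub>M D)"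
      by (rule measurable_compose[OF _ measurable_ennreal])
    from D.nn_integral_fst[OF this] show ?thesis by simp
  qed
  also have "\<dots> = (\<integral>\<^sup>+x. ennreal (c * (f x - f xstar)) \<partial>\<mu>)"
  proof (rule nn_integral_cong)
    fix x
    have hb: "has_bochner_integral D (dec x) (c * (f x - f xstar))"
      unfolding dec_def by (rule mean_separable_decrease(2)[OF min])
    have "AE T in D. 0 \<le> dec x T"
      unfolding dec_def by (rule mean_separable_decrease(1)[OF min])
    from nn_integral_eq_integral[OF _ this] hb
    show "(\<integral>\<^sup>+T. ennreal (dec x T) \<partial>D) = ennreal (c * (f x - f xstar))"
      by (simp add: has_bochner_integral_iff)
  qed
  also have "\<dots> = (\<integral>\<^sup>+\<omega>. ennreal (c * (f (X k \<omega>) - f xstar)) \<partial>M)"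
  proof -
    have "(\<lambda>x. ennreal (c * (f x - f xstar))) \<in> borel_measurable borel"
      using borel_measurable_continuous_onI[OF continuous_f] by measurable
    then show ?thesis unfolding \<mu>_def by (subst nn_integral_distr[OF X]) auto
  qed
  also have "\<dots> = ennreal (LINT \<omega>|M. c * (f (X k \<omega>) - f xstar))"
    using int c_pos gap_nonneg by (intro nn_integral_eq_integral) auto
  finally have nn: "(\<integral>\<^sup>+\<omega>. ennreal (dec (X k \<omega>) (S k \<omega>)) \<partial>M) = ennreal (c * (LINT \<omega>|M. f (X k \<omega>) - f xstar))"
    by simp
  have const: "AE \<omega> in M. \<forall>x. sketch_proj f (S k \<omega>) x = sketch_proj f (S k \<omega>) 0"
    by (rule AE_distrD[OF S], unfold distr, rule AE_sketch_proj_constant)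
  have dec_nonneg: "AE \<omega> in M. 0 \<le> dec (X k \<omega>) (S k \<omega>)"
    using const
  proof (rule AE_mp, intro AE_I2 impI)
    fix \<omega> assume "\<forall>x. sketch_proj f (S k \<omega>) x = sketch_proj f (S k \<omega>) 0"
    from constant_sketch_proj_decrease[OF this min, of "X k \<omega>"]
    show "0 \<le> dec (X k \<omega>) (S k \<omega>)" by (simp add: dec_def)
  qed
  have dec_M: "(\<lambda>\<omega>. dec (X k \<omega>) (S k \<omega>)) \<in> borel_measurable M"
    using measurable_compose[OF measurable_Pair[OF X S] dec_meas] by simp
  have dec_int: "integrable M (\<lambda>\<omega>. dec (X k \<omega>) (S k \<omega>))"
    by (rule integrableI_nonneg[OF dec_M dec_nonneg]) (simp add: nn)
  have dec_mean: "(LINT \<omega>|M. dec (X k \<omega>) (S k \<omega>)) = c * (LINT \<omega>|M. f (X k \<omega>) - f xstar)"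
    using nn_integral_eq_integral[OF dec_int dec_nonneg] nn c_pos gap_nonneg dec_nonneg
    by (simp add: integral_nonneg_AE)
  have b0: "0 < b" by (simp add: b_def)
  have step: "AE \<omega> in M. f (X (Suc k) \<omega>) \<le> f (X k \<omega>) \<and>
      f (X (Suc k) \<omega>) - f xstar \<le> (f (X k \<omega>) - f xstar) - dec (X k \<omega>) (S k \<omega>) / b"
    using regime
  proof (rule AE_mp, intro AE_I2 impI)
    fix \<omega>
    assume r: "sketch_dual_norm f (X k \<omega>) (S k \<omega>) (sketch_grad f (S k \<omega>) (X k \<omega>)) \<le> 1 / L"
    have X_Suc: "X (Suc k) \<omega> = sgn_step f L_alg (S k \<omega>) (X k \<omega>)" by (simp add: X_def)
    have "sketch_proj f (S k \<omega>) 0 *v (xstar - X k \<omega>) \<in> span (set (S k \<omega>))"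
      by (rule sketch_proj_in_span[OF hess_pd])
    note progress = sgn_step_progress[OF L L0 L_alg r this, folded b_def X_Suc]
    have "dec (X k \<omega>) (S k \<omega>) \<le> b * (f (X k \<omega>) - f (X (Suc k) \<omega>))"
      using progress(1) by (simp add: dec_def)
    then have "dec (X k \<omega>) (S k \<omega>) / b \<le> f (X k \<omega>) - f (X (Suc k) \<omega>)"
      using b0 by (simp add: pos_divide_le_eq mult.commute)
    with progress(2) show "f (X (Suc k) \<omega>) \<le> f (X k \<omega>) \<and>
      f (X (Suc k) \<omega>) - f xstar \<le> (f (X k \<omega>) - f xstar) - dec (X k \<omega>) (S k \<omega>) / b" by simp
  qed
  show int': "integrable M (\<lambda>\<omega>. f (X (Suc k) \<omega>) - f xstar)"
  proof (rule Bochner_Integration.integrable_bound[OF int])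
    show "(\<lambda>\<omega>. f (X (Suc k) \<omega>) - f xstar) \<in> borel_measurable M"
      by (intro borel_measurable_diff borel_measurable_const borel_measurable_continuous_on[OF continuous_f X])
    show "AE \<omega> in M. norm (f (X (Suc k) \<omega>) - f xstar) \<le> norm (f (X k \<omega>) - f xstar)"
      using step by (rule AE_mp) (intro AE_I2 impI, simp add: min)
  qed
  have "(LINT \<omega>|M. f (X (Suc k) \<omega>) - f xstar)
      \<le> (LINT \<omega>|M. (f (X k \<omega>) - f xstar) - dec (X k \<omega>) (S k \<omega>) / b)"
    by (rule integral_mono_AE[OF int' Bochner_Integration.integrable_diff[OF int integrable_divide]])
      (use dec_int step in auto)
  also have "\<dots> = (LINT \<omega>|M. f (X k \<omega>) - f xstar) - (LINT \<omega>|M. dec (X k \<omega>) (S k \<omega>) / b)"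
    by (rule Bochner_Integration.integral_diff[OF int integrable_divide]) (use dec_int in auto)
  also have "\<dots> = (1 - c / b) * (LINT \<omega>|M. f (X k \<omega>) - f xstar)"
    by (simp only: integral_divide_zero dec_mean) (simp add: algebra_simps)
  finally show "(LINT \<omega>|M. f (X (Suc k) \<omega>) - f xstar) \<le> (1 - c / b) * (LINT \<omega>|M. f (X k \<omega>) - f xstar)" .
qed

lemma sgn_linear_convergence:
  assumes M: "prob_space M"
    and indep: "prob_space.indep_vars M (\<lambda>_. sketch_space) S UNIV"
    and distr: "\<And>k. distr M sketch_space (S k) = D"
    and L: "semi_strongly_self_concordant L f" and L0: "0 < L" and L_alg: "L \<le> L_alg"
    and min: "\<And>y. f xstar \<le> f y"
    and regime: "sgn_local_regime M f L L_alg x0 S k"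
  shows "integrable M (\<lambda>\<omega>. f (sgn_iterate f L_alg x0 (\<lambda>j. S j \<omega>) k) - f xstar) \<and>
    (LINT \<omega>|M. f (sgn_iterate f L_alg x0 (\<lambda>j. S j \<omega>) k) - f xstar)
      \<le> (1 - c / max (sqrt (L_alg / L)) 2) ^ k * (f x0 - f xstar)"
  using regime
proof (induction k)
  case 0
  interpret prob_space M by fact
  show ?case by (simp add: prob_space)
next
  case (Suc k)
  define b where "b = max (sqrt (L_alg / L)) 2"
  have "sgn_local_regime M f L L_alg x0 S k"
    using Suc.prems unfolding sgn_local_regime_def by (rule AE_mp) (intro AE_I2 impI, simp)
  note IH = Suc.IH[OF this, folded b_def]
  have r: "AE \<omega> in M. sketch_dual_norm f (sgn_iterate f L_alg x0 (\<lambda>j. S j \<omega>) k) (S k \<omega>)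
      (sketch_grad f (S k \<omega>) (sgn_iterate f L_alg x0 (\<lambda>j. S j \<omega>) k)) \<le> 1 / L"
    using Suc.prems unfolding sgn_local_regime_def
  proof (rule AE_mp, intro AE_I2 impI)
    fix \<omega>
    assume "\<forall>t\<le>Suc k. let x = sgn_iterate f L_alg x0 (\<lambda>j. S j \<omega>) t in
           sketch_dual_norm f x (S t \<omega>) (sketch_grad f (S t \<omega>) x) \<le> 1 / L \<and>
           grad f x \<in> range (\<lambda>v. hess f x *v v)"
    from this[rule_format, of k]
    show "sketch_dual_norm f (sgn_iterate f L_alg x0 (\<lambda>j. S j \<omega>) k) (S k \<omega>)
      (sketch_grad f (S k \<omega>) (sgn_iterate f L_alg x0 (\<lambda>j. S j \<omega>) k)) \<le> 1 / L"
      by (simp add: Let_def)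
  qed
  note step = sgn_expected_decrease[OF M indep distr L L0 L_alg min r conjunct1[OF IH], folded b_def]
  have "c / b \<le> 1 / 2" using c_le_1 c_pos by (intro frac_le) (auto simp: b_def)
  then have "0 \<le> 1 - c / b" by linarith
  then have "(1 - c / b) * (LINT \<omega>|M. f (sgn_iterate f L_alg x0 (\<lambda>j. S j \<omega>) k) - f xstar)
      \<le> (1 - c / b) * ((1 - c / b) ^ k * (f x0 - f xstar))"
    using IH by (intro mult_left_mono) auto
  with step show ?case unfolding b_def[symmetric] by (simp add: mult.assoc)
qed

end

lemma linear_rate_iteration_count:
  fixes q \<kappa> \<epsilon> :: real
  assumes q: "0 < q" "q \<le> 2 * \<kappa>" and c: "0 < c" "c \<le> q" and \<epsilon>: "0 < \<epsilon>" "\<epsilon> < 1"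
    and k: "2 * \<kappa> * (1 / c) * ln (1 / \<epsilon>) \<le> real k"
  shows "(1 - c / q) ^ k \<le> \<epsilon>"
proof -
  have "0 < ln (1 / \<epsilon>)" using \<epsilon> by (intro ln_gt_zero) simp
  have "q / c * ln (1 / \<epsilon>) \<le> 2 * \<kappa> / c * ln (1 / \<epsilon>)"
    using q c \<open>0 < ln (1 / \<epsilon>)\<close> by (intro mult_right_mono divide_right_mono) auto
  also have "\<dots> \<le> real k" using k by simp
  finally have "ln (1 / \<epsilon>) \<le> real k * (c / q)" using q c by (simp add: field_simps)
  then have *: "- (real k * (c / q)) \<le> ln \<epsilon>" using \<epsilon> by (simp add: ln_div)
  have "(1 - c / q) ^ k \<le> exp (- (c / q)) ^ k"
    using exp_ge_add_one_self[of "- (c / q)"] q c by (intro power_mono) auto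
  also have "\<dots> = exp (- (real k * (c / q)))" by (simp add: exp_of_nat_mult[symmetric])
  also have "\<dots> \<le> exp (ln \<epsilon>)" using * by simp
  finally show ?thesis using \<epsilon> by simp
qed

theorem theorem3:
  fixes f :: "real^'d \<Rightarrow> real"
    and x0 xstar :: "real^'d"
    and M :: "'w measure"
    and D :: "'d sketch measure"
    and S :: "nat \<Rightarrow> 'w \<Rightarrow> 'd sketch"
    and L_sketch :: "'d sketch \<Rightarrow> real"
    and L_semi L_alg \<tau> b :: real
  assumes f_convex: "convex_on UNIV f"
    and f_smooth: "thrice_differentiable f"
    and f_hess: "\<And>x. positive_definite (hess f x)"
    and f_bdd: "bdd_below (range f)"
    and f_min: "\<And>x. f xstar \<le> f x"
    and M: "prob_space M"
    and S_indep: "prob_space.indep_vars M (\<lambda>_. sketch_space) S UNIV"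
    and S_distr: "\<And>k. distr M sketch_space (S k) = D"
    and f_sketch_sc: "AE T in D. self_concordant_in_range (L_sketch T) T f"
    and L_semi: "0 < L_semi"
    and f_semi_sc: "semi_strongly_self_concordant L_semi f"
    and L_alg: "L_semi \<le> L_alg"
    and \<tau>: "0 < \<tau>"
    and proj_mean: "\<And>x. (LINT T|D. sketch_proj f T x) = (\<tau> / real CARD('d)) *\<^sub>R Finite_Cartesian_Product.mat 1"
    and b: "b = max (sqrt (L_alg / L_semi)) 2"
  shows
    "(\<forall>k. sgn_local_regime M f L_semi L_alg x0 S k \<longrightarrow>
        integrable M (\<lambda>\<omega>. f (sgn_iterate f L_alg x0 (\<lambda>j. S j \<omega>) k) - f xstar) \<and>
        (LINT \<omega>|M. f (sgn_iterate f L_alg x0 (\<lambda>j. S j \<omega>) k) - f xstar)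
          \<le> (1 - \<tau> / (b * real CARD('d))) ^ k * (f x0 - f xstar)) \<and>
     (\<forall>\<epsilon> k. 0 < \<epsilon> \<and> \<epsilon> < 1 \<and> sgn_local_regime M f L_semi L_alg x0 S k \<and>
        2 * sqrt (L_alg / L_semi) * (real CARD('d) / \<tau>) * ln (1 / \<epsilon>) \<le> real k \<longrightarrow>
        (LINT \<omega>|M. f (sgn_iterate f L_alg x0 (\<lambda>j. S j \<omega>) k) - f xstar)
          \<le> \<epsilon> * (f x0 - f xstar)) \<and>
     (L_alg = L_semi \<longrightarrow>
      (\<forall>\<epsilon> k. 0 < \<epsilon> \<and> \<epsilon> < 1 \<and> sgn_local_regime M f L_semi L_alg x0 S k \<and>
        2 * (real CARD('d) / \<tau>) * ln (1 / \<epsilon>) \<le> real k \<longrightarrow>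
        (LINT \<omega>|M. f (sgn_iterate f L_alg x0 (\<lambda>j. S j \<omega>) k) - f xstar)
          \<le> \<epsilon> * (f x0 - f xstar)))"
proof -
  define c where "c = \<tau> / real CARD('d)"
  have c0: "0 < c" using \<tau> by (simp add: c_def)
  have SM: "S 0 \<in> M \<rightarrow>\<^sub>M sketch_space"
    using S_indep by (auto simp: prob_space.indep_vars_def[OF M])
  interpret D: prob_space D
    using prob_space.prob_space_distr[OF M SM] unfolding S_distr .
  interpret isotropic_sketches f D c
    using f_smooth f_hess c0 proj_mean S_distr[of 0, symmetric]
    by unfold_locales (simp_all add: c_def)
  have rate: "\<tau> / (b * real CARD('d)) = c / b" by (simp add: c_def field_simps)
  have main: "integrable M (\<lambda>\<omega>. f (sgn_iterate f L_alg x0 (\<lambda>j. S j \<omega>) k) - f xstar) \<and>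
      (LINT \<omega>|M. f (sgn_iterate f L_alg x0 (\<lambda>j. S j \<omega>) k) - f xstar) \<le> (1 - c / b) ^ k * (f x0 - f xstar)"
    if "sgn_local_regime M f L_semi L_alg x0 S k" for k
    unfolding b by (rule sgn_linear_convergence[OF M S_indep S_distr f_semi_sc L_semi L_alg f_min that])
  have complexity: "(LINT \<omega>|M. f (sgn_iterate f L_alg x0 (\<lambda>j. S j \<omega>) k) - f xstar) \<le> \<epsilon> * (f x0 - f xstar)"
    if "0 < \<epsilon>" "\<epsilon> < 1" "sgn_local_regime M f L_semi L_alg x0 S k"
      "2 * sqrt (L_alg / L_semi) * (real CARD('d) / \<tau>) * ln (1 / \<epsilon>) \<le> real k" for \<epsilon> k
  proof -
    \<comment> \<open>The iteration count is governed by \<open>sqrt \<kappa>\<close> alone, because \<open>max (sqrt \<kappa>) 2 \<le> 2 sqrt \<kappa>\<close> for \<open>\<kappa> \<ge> 1\<close>.\<close>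
    have "1 \<le> sqrt (L_alg / L_semi)" using L_semi L_alg by simp
    then have "b \<le> 2 * sqrt (L_alg / L_semi)" and "2 \<le> b" by (auto simp: b)
    have "(1 - c / b) ^ k \<le> \<epsilon>"
    proof (intro linear_rate_iteration_count[where \<kappa> = "sqrt (L_alg / L_semi)"])
      show "0 < b" "c \<le> b" using c_le_1 \<open>2 \<le> b\<close> by linarith+
      show "b \<le> 2 * sqrt (L_alg / L_semi)" by fact
      show "2 * sqrt (L_alg / L_semi) * (1 / c) * ln (1 / \<epsilon>) \<le> real k" using that(4) by (simp add: c_def)
    qed (use that c0 in auto)
    then have "(1 - c / b) ^ k * (f x0 - f xstar) \<le> \<epsilon> * (f x0 - f xstar)"
      using f_min[of x0] by (intro mult_right_mono) auto
    with main[OF that(3)] show ?thesis by linarith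
  qed
  show ?thesis
    unfolding rate using main complexity L_semi by auto
qed

end
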